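(* Let $M$ be a segment cactus with $m$ segments which is not a set of 3 segments with exactly 3 intersection points. Then $M$ has an EFL coloring with $m-1$ colors. Moreover, there exist segment cactus graphs, none of which is a set of 3 segments with 3 intersection points, that do not have an EFL coloring with $m-2$ colors.
   Context: $M$ is a finite set of line segments of nonzero length in the plane; collinear intersecting segments are treated as a single segment. $P(M)$ is the set of points lying on at least two segments, $J(M)$ the set of segment endpoints. $G_M$ is the graph with vertex set $P(M)\cup J(M)$ where $u,v$ are adjacent iff some segment $s\in M$ contains both and no point of $P(M)\cup J(M)$ lies on $s$ strictly between them. $M$ is a segment cactus if $G_M$ is a cactus graph (any two cycles share at most one vertex). An EFL coloring of $M$ with $k$ colors is a function $f:P(M)\rightarrow\{1,\ldots,k\}$ such that any two distinct intersection points lying on a common segment of $M$ receive different colors. *)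

theory Defs
  imports "HOL-Analysis.Analysis"
begin

type_synonym point = "real ^ 2"

definition is_segment :: "point set \<Rightarrow> bool" where
  "is_segment s \<longleftrightarrow> (\<exists>a b. a \<noteq> b \<and> s = closed_segment a b)"

definition endpoints :: "point set \<Rightarrow> point set" where
  "endpoints s = {a. \<exists>b. s = closed_segment a b}"

lemma endpoints_closed_segment: "endpoints (closed_segment a b) = {a, b}"
  by (auto simp: endpoints_def closed_segment_eq doubleton_eq_iff)

text \<open>
  The convention that collinear intersecting segments count as a single segment is expressed
  by requiring that they have already been merged: distinct segments of the set that
  intersect are never collinear.
\<close>
definition segment_set :: "point set set \<Rightarrow> bool" where
  "segment_set M \<longleftrightarrow>
     finite M \<and> (\<forall>s\<in>M. is_segment s) \<and>
     (\<forall>s\<in>M. \<forall>t\<in>M. s \<noteq> t \<and> s \<inter> t \<noteq> {} \<longrightarrow> \<not> collinear (s \<union> t))"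

definition intersection_points :: "point set set \<Rightarrow> point set" where
  "intersection_points M = {p. \<exists>s\<in>M. \<exists>t\<in>M. s \<noteq> t \<and> p \<in> s \<and> p \<in> t}"

definition segment_endpoints :: "point set set \<Rightarrow> point set" where
  "segment_endpoints M = (\<Union>s\<in>M. endpoints s)"

definition seg_verts :: "point set set \<Rightarrow> point set" where
  "seg_verts M = intersection_points M \<union> segment_endpoints M"

definition seg_adj :: "point set set \<Rightarrow> point \<Rightarrow> point \<Rightarrow> bool" where
  "seg_adj M u v \<longleftrightarrow>
     u \<in> seg_verts M \<and> v \<in> seg_verts M \<and> u \<noteq> v \<and>
     (\<exists>s\<in>M. u \<in> s \<and> v \<in> s \<and> \<not> (\<exists>w\<in>seg_verts M. w \<in> s \<and> w \<in> open_segment u v))"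

text \<open>
  A cycle of a simple graph with vertex set \<open>V\<close> and adjacency relation \<open>adj\<close> is given by the
  list of its vertices in cyclic order.  Lists that differ by rotation or reversal describe
  the same cycle, so cycles are compared through their edge sets.
\<close>
definition is_cycle :: "'a set \<Rightarrow> ('a \<Rightarrow> 'a \<Rightarrow> bool) \<Rightarrow> 'a list \<Rightarrow> bool" where
  "is_cycle V adj xs \<longleftrightarrow>
     length xs \<ge> 3 \<and> distinct xs \<and> set xs \<subseteq> V \<and>
     (\<forall>i<length xs. adj (xs ! i) (xs ! (Suc i mod length xs)))"

definition cycle_edges :: "'a list \<Rightarrow> 'a set set" where
  "cycle_edges xs = {{xs ! i, xs ! (Suc i mod length xs)} | i. i < length xs}"

definition is_cactus :: "'a set \<Rightarrow> ('a \<Rightarrow> 'a \<Rightarrow> bool) \<Rightarrow> bool" where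
  "is_cactus V adj \<longleftrightarrow>
     (\<forall>xs ys. is_cycle V adj xs \<and> is_cycle V adj ys \<and> cycle_edges xs \<noteq> cycle_edges ys \<longrightarrow>
        card (set xs \<inter> set ys) \<le> 1)"

definition segment_cactus :: "point set set \<Rightarrow> bool" where
  "segment_cactus M \<longleftrightarrow> segment_set M \<and> is_cactus (seg_verts M) (seg_adj M)"

definition EFL_coloring :: "point set set \<Rightarrow> nat \<Rightarrow> (point \<Rightarrow> nat) \<Rightarrow> bool" where
  "EFL_coloring M k f \<longleftrightarrow>
     f \<in> intersection_points M \<rightarrow> {1..k} \<and>
     (\<forall>s\<in>M. \<forall>p\<in>intersection_points M \<inter> s. \<forall>q\<in>intersection_points M \<inter> s.
        p \<noteq> q \<longrightarrow> f p \<noteq> f q)"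

end

theory Submission
  imports Defs
begin

text \<open>
  A cactus on \<open>v\<close> vertices has few edges, and every cycle of \<open>G_M\<close> has at least three of its
  vertices in \<open>P(M)\<close>, since the extreme points of its convex hull are such points. Counting the
  edges of \<open>G_M\<close> on the segments of a subfamily \<open>N\<close> gives
  \<open>\<Sum>\<^bsub>p\<^esub> d(p) \<le> |N| + 3/2 (|P(N)| - 1)\<close>, where \<open>p\<close> ranges over \<open>P(N)\<close> and \<open>d(p)\<close> is the number of
  segments of \<open>N\<close> through \<open>p\<close>. This bound, which is inherited by all subfamilies, is the only
  consequence of the cactus property that the colouring uses.

  The colouring is by induction on the number \<open>m\<close> of segments. The bound provides a segment with at
  most one point of degree at least \<open>3\<close> and few points of degree \<open>2\<close>. Remove it, colour the rest with
  \<open>m - 2\<close> colours, and colour the lost degree-\<open>2\<close> points using one new colour and otherwise old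
  ones. This can only fail if two segments meet all others in distinct points; then the bound is
  tight, all other segments carry exactly two points, and a cyclic shift gives a colouring.

  For the lower bound take a comb: one segment with \<open>m - 1\<close> pairwise disjoint teeth.
\<close>

section \<open>Edges of a cactus graph\<close>

definition simple_path :: "('a \<times> 'a) set \<Rightarrow> 'a list \<Rightarrow> bool" where
  "simple_path A xs \<longleftrightarrow> distinct xs \<and> successively (\<lambda>u v. (u, v) \<in> A) xs"

text \<open>A cycle with its closing edge \<open>(last xs, hd xs)\<close> kept apart, so that cycles
  can be cut, rotated and spliced as lists without indices modulo the length. \<open>A\<close>
  consists of ordered pairs, so a symmetric \<open>A\<close> counts each edge twice.\<close>

definition closed_path :: "('a \<times> 'a) set \<Rightarrow> 'a list \<Rightarrow> bool" where
  "closed_path A xs \<longleftrightarrow> simple_path A xs \<and> length xs \<ge> 3 \<and> (last xs, hd xs) \<in> A"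

lemma is_cycle_iff_closed_path:
  assumes "A \<subseteq> V \<times> V"
  shows "is_cycle V (\<lambda>u v. (u, v) \<in> A) xs \<longleftrightarrow> closed_path A xs"
proof
  assume c: "is_cycle V (\<lambda>u v. (u, v) \<in> A) xs"
  then have l: "length xs \<ge> 3" and d: "distinct xs"
    and a: "\<And>i. i < length xs \<Longrightarrow> (xs ! i, xs ! (Suc i mod length xs)) \<in> A"
    by (auto simp: is_cycle_def)
  have "(xs ! i, xs ! Suc i) \<in> A" if "Suc i < length xs" for i
    using a[of i] that by simp
  moreover have "(last xs, hd xs) \<in> A"
    using a[of "length xs - 1"] l by (cases xs) (auto simp: last_conv_nth)
  ultimately show "closed_path A xs"
    using l d by (auto simp: closed_path_def simple_path_def successively_conv_nth)
next
  assume c: "closed_path A xs"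
  then have l: "length xs \<ge> 3" and d: "distinct xs" and h: "(last xs, hd xs) \<in> A"
    and a: "\<And>i. Suc i < length xs \<Longrightarrow> (xs ! i, xs ! Suc i) \<in> A"
    by (auto simp: closed_path_def simple_path_def successively_conv_nth)
  have e: "(xs ! i, xs ! (Suc i mod length xs)) \<in> A" if "i < length xs" for i
  proof (cases "Suc i < length xs")
    case False
    then have "i = length xs - 1" using that by simp
    moreover have "xs \<noteq> []" using l by auto
    ultimately show ?thesis using h by (simp add: last_conv_nth hd_conv_nth)
  qed (use a in simp)
  have "set xs \<subseteq> V"
    using e assms by (fastforce simp: in_set_conv_nth)
  with l d e show "is_cycle V (\<lambda>u v. (u, v) \<in> A) xs" by (simp add: is_cycle_def)
qed

lemma closed_path_mono: "closed_path A xs \<Longrightarrow> A \<subseteq> B \<Longrightarrow> closed_path B xs"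
  by (auto simp: closed_path_def simple_path_def successively_conv_nth)

lemma is_cycle_mono:
  "is_cycle V r xs \<Longrightarrow> V \<subseteq> V' \<Longrightarrow> (\<And>u v. r u v \<Longrightarrow> r' u v) \<Longrightarrow> is_cycle V' r' xs"
  unfolding is_cycle_def by blast

lemma is_cactus_mono:
  "is_cactus V' r' \<Longrightarrow> V \<subseteq> V' \<Longrightarrow> (\<And>u v. r u v \<Longrightarrow> r' u v) \<Longrightarrow> is_cactus V r"
  unfolding is_cactus_def by (meson is_cycle_mono)

lemma closed_path_rotate:
  assumes "closed_path A (xs @ ys)"
  shows "closed_path A (ys @ xs)"
  using assms
  by (cases "xs = []"; cases "ys = []")
    (auto simp: closed_path_def simple_path_def successively_append_iff)

text \<open>Cycles are compared by their edge sets. Since these determine the vertices, a cycle with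
  a vertex outside another cycle differs from it.\<close>

lemma Union_cycle_edges:
  assumes "length xs \<ge> 3"
  shows "\<Union> (cycle_edges xs) = set xs"
proof
  show "\<Union> (cycle_edges xs) \<subseteq> set xs"
    using assms by (auto simp: cycle_edges_def intro!: nth_mem mod_less_divisor)
  show "set xs \<subseteq> \<Union> (cycle_edges xs)"
  proof
    fix x assume "x \<in> set xs"
    then obtain i where "i < length xs" "x = xs ! i" by (auto simp: in_set_conv_nth)
    then have "{x, xs ! (Suc i mod length xs)} \<in> cycle_edges xs" by (auto simp: cycle_edges_def)
    then show "x \<in> \<Union> (cycle_edges xs)" by blast
  qed
qed

lemma closing_edge_in_cycle_edges:
  assumes "xs \<noteq> []"
  shows "{last xs, hd xs} \<in> cycle_edges xs"
  unfolding cycle_edges_def mem_Collect_eq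
  by (rule exI[of _ "length xs - 1"]) (use assms in \<open>simp add: last_conv_nth hd_conv_nth\<close>)

lemma cycle_edges_subset:
  assumes "is_cycle V (\<lambda>u v. (u, v) \<in> A) xs" "{u, v} \<in> cycle_edges xs"
  shows "(u, v) \<in> A \<or> (v, u) \<in> A"
  using assms unfolding is_cycle_def cycle_edges_def by (auto simp: doubleton_eq_iff)

lemma cactus_closed_paths:
  assumes "A \<subseteq> V \<times> V" "is_cactus V (\<lambda>u v. (u, v) \<in> A)"
    and "closed_path A xs" "closed_path A ys" "cycle_edges xs \<noteq> cycle_edges ys"
    and "x \<in> set xs" "x \<in> set ys" "y \<in> set xs" "y \<in> set ys"
  shows "x = y"
proof -
  have "card (set xs \<inter> set ys) \<le> 1"
    using assms is_cycle_iff_closed_path[OF assms(1)] unfolding is_cactus_def by blast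
  then show ?thesis
    using assms(6-9) by (auto simp: card_le_Suc0_iff_eq)
qed

text \<open>
  Among all cycles with an attached path (leaving the cycle at \<open>last c\<close>), one with the longest
  path has the property below: a second cycle through another vertex of \<open>c\<close> could be prolonged
  by an arc of \<open>c\<close> and the path.
\<close>
lemma cactus_end_cycle:
  fixes A :: "('a \<times> 'a) set"
  assumes fin: "finite V" and A: "A \<subseteq> V \<times> V" and cactus: "is_cactus V (\<lambda>u v. (u, v) \<in> A)"
    and "closed_path A c0"
  obtains c where "closed_path A c"
    and "\<And>d x. closed_path A d \<Longrightarrow> cycle_edges d \<noteq> cycle_edges c \<Longrightarrow> x \<in> set c \<Longrightarrow> x \<in> set d \<Longrightarrow>
           x = last c"
proof -
  \<comment> \<open>\<open>L n\<close> says that some cycle carries a tail of \<open>n\<close>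
    further vertices, attached at its last vertex and disjoint from it. Tails are simple paths
    inside \<open>V\<close>, so a longest one exists.\<close>
  define L where "L n \<longleftrightarrow> (\<exists>c t. closed_path A c \<and> simple_path A (c @ t) \<and> length t = n)" for n
  have "L 0"
    unfolding L_def using assms(4) by (auto simp: closed_path_def)
  moreover have "n \<le> card V" if "L n" for n
  proof -
    obtain c t where ct: "closed_path A c" "simple_path A (c @ t)" "length t = n"
      using \<open>L n\<close> unfolding L_def by blast
    have "set t \<subseteq> V"
    proof
      fix x assume "x \<in> set t"
      then obtain t1 t2 where t: "t = t1 @ x # t2" by (meson split_list)
      have "c @ t1 \<noteq> []" using ct(1) by (auto simp: closed_path_def)
      moreover have "successively (\<lambda>u v. (u, v) \<in> A) ((c @ t1) @ x # t2)"
        using ct(2) unfolding simple_path_def t by simp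
      ultimately have "(last (c @ t1), x) \<in> A"
        unfolding successively_append_iff by (metis list.sel(1) list.discI)
      then show "x \<in> V" using A by auto
    qed
    moreover have "distinct t" using ct(2) by (auto simp: simple_path_def)
    ultimately show ?thesis
      using ct(3) fin by (metis card_mono distinct_card)
  qed
  ultimately obtain n where "L n" and n: "\<And>k. L k \<Longrightarrow> k \<le> n"
    using Nat.ex_has_greatest_nat[of L 0 "card V"] by blast
  then obtain c t where c: "closed_path A c" and ct: "simple_path A (c @ t)" and t: "length t = n"
    unfolding L_def by blast
  have "x = last c" if "closed_path A d0" and ne: "cycle_edges d0 \<noteq> cycle_edges c"
    and xc: "x \<in> set c" and xd: "x \<in> set d0" for d0 x
  proof (rule ccontr)
    assume "x \<noteq> last c"
    obtain d1 d2 where d12: "d0 = d1 @ x # d2"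
      using split_list[OF xd] by blast
    \<comment> \<open>The second cycle is rotated so that it ends in \<open>x\<close>, the vertex it
      shares with \<open>c\<close>.\<close>
    define d where "d = d2 @ d1 @ [x]"
    have d: "closed_path A d"
      using closed_path_rotate[of A "d1 @ [x]" d2] \<open>closed_path A d0\<close> unfolding d12 d_def by simp
    have "last d = x" "set d = set d0" by (auto simp: d_def d12)
    have only: "y = x" if "y \<in> set c" "y \<in> set d" for y
      using cactus_closed_paths[OF A cactus \<open>closed_path A d0\<close> c ne] that xc xd \<open>set d = set d0\<close>
      by blast
    obtain c1 c2 where c12: "c = c1 @ x # c2"
      using split_list[OF xc] by blast
    then have "c2 \<noteq> []" using \<open>x \<noteq> last c\<close> by auto
    have last_c: "last c \<in> set c2" using c12 \<open>c2 \<noteq> []\<close> by simp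
    have path: "distinct (c1 @ x # c2 @ t)" "successively (\<lambda>u v. (u, v) \<in> A) (x # c2 @ t)"
      using ct unfolding simple_path_def c12 by (auto simp: successively_append_iff)
    have dpath: "distinct d" "successively (\<lambda>u v. (u, v) \<in> A) d"
      using d by (auto simp: closed_path_def simple_path_def)
    have disj: "set d \<inter> set c2 = {}"
    proof -
      have "x \<notin> set c2" using path by auto
      moreover have "set c2 \<subseteq> set c" using c12 by auto
      ultimately show ?thesis using only by blast
    qed
    show False
    \<comment> \<open>If the tail avoids \<open>d\<close>, then \<open>d\<close> with the tail
      \<open>c2 @ t\<close> beats the maximal length, because \<open>c2\<close> is nonempty.\<close>
    proof (cases "set d \<inter> set t = {}")
      case True
      have "(x, hd (c2 @ t)) \<in> A"
        using path(2) \<open>c2 \<noteq> []\<close> by (cases c2) auto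
      then have "simple_path A (d @ c2 @ t)"
        using dpath path True disj \<open>last d = x\<close>
        by (auto simp: simple_path_def successively_append_iff successively_Cons)
      then have "L (length (c2 @ t))"
        unfolding L_def using d by blast
      then show False using n[of "length (c2 @ t)"] t \<open>c2 \<noteq> []\<close> by simp
    next
      case False
      then obtain y where "y \<in> set t" "y \<in> set d" by blast
      then obtain t1 y t2 where t12: "t = t1 @ y # t2" and y: "y \<in> set d"
        and t1: "\<forall>z\<in>set t1. z \<notin> set d"
        using split_list_first_prop[of t "\<lambda>z. z \<in> set d"] by blast
      obtain e1 e2 where e12: "d = e1 @ y # e2"
        using split_list[OF y] by blast
      have "y \<noteq> x" using path t12 by auto
      then have "e2 \<noteq> []" and "last e2 = x" using \<open>last d = x\<close> e12 by (auto split: if_splits)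
      \<comment> \<open>From \<open>x\<close> go along \<open>c2\<close>, then along the tail to its
        first vertex \<open>y\<close> on \<open>d\<close>, then along \<open>d\<close> back to
        \<open>x\<close>. This cycle shares \<open>x\<close> and \<open>last c\<close> with
        \<open>c\<close>, yet it contains \<open>y\<close>, which is not on
        \<open>c\<close>.\<close>
      define F where "F = c2 @ t1 @ y # e2"
      have "(x, hd c2) \<in> A"
        using path(2) \<open>c2 \<noteq> []\<close> by (cases c2) auto
      have "successively (\<lambda>u v. (u, v) \<in> A) ((c2 @ t1) @ [y])"
        using path(2) unfolding t12
        by (auto simp: successively_append_iff successively_Cons hd_append)
      moreover have "successively (\<lambda>u v. (u, v) \<in> A) ([y] @ e2)"
        using dpath(2) unfolding e12 by (auto simp: successively_append_iff)
      ultimately have "successively (\<lambda>u v. (u, v) \<in> A) ((c2 @ t1) @ [y] @ e2)"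
        by (auto simp: successively_append_iff hd_append split: if_splits)
      moreover have "distinct F"
        using path(1) dpath(1) disj t1 unfolding F_def t12 e12 by auto
      moreover have "length F \<ge> 3"
        using \<open>c2 \<noteq> []\<close> \<open>e2 \<noteq> []\<close> by (cases c2; cases e2) (auto simp: F_def)
      ultimately have F: "closed_path A F"
        using \<open>(x, hd c2) \<in> A\<close> \<open>c2 \<noteq> []\<close> \<open>e2 \<noteq> []\<close> \<open>last e2 = x\<close>
        by (auto simp: closed_path_def simple_path_def F_def)
      have "y \<in> set F" "y \<notin> set c"
        using path(1) by (auto simp: F_def c12 t12)
      then have "cycle_edges F \<noteq> cycle_edges c"
        using Union_cycle_edges[of F] Union_cycle_edges[of c] F c
        by (auto simp: closed_path_def)
      moreover have "x \<in> set F" "last c \<in> set F" "last c \<in> set c"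
        using \<open>last e2 = x\<close> \<open>e2 \<noteq> []\<close> last_c by (auto simp: F_def c12)
      ultimately show False
        using cactus_closed_paths[OF A cactus F c] xc \<open>x \<noteq> last c\<close> by blast
    qed
  qed
  with c show thesis by (rule that)
qed

section \<open>Edge bounds for forests and cacti\<close>

lemma acyclic_edge_bound:
  assumes "finite V" "V \<noteq> {}" "A \<subseteq> V \<times> V" "sym A" "irrefl A" "\<And>c. \<not> closed_path A c"
  shows "card A + 2 \<le> 2 * card V"
  using assms
proof (induction "card V" arbitrary: V A)
  case 0
  then show ?case by simp
next
  case (Suc n)
  define L where "L k \<longleftrightarrow> (\<exists>xs. simple_path A xs \<and> set xs \<subseteq> V \<and> length xs = k)" for k
  obtain v0 where "v0 \<in> V" using Suc.prems by blast
  then have "L 1"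
    unfolding L_def by (intro exI[of _ "[v0]"]) (auto simp: simple_path_def)
  moreover have "k \<le> card V" if "L k" for k
    using that Suc.prems(1) unfolding L_def simple_path_def by (metis card_mono distinct_card)
  ultimately obtain k where "L k" and k: "\<And>j. L j \<Longrightarrow> j \<le> k"
    using Nat.ex_has_greatest_nat[of L 1 "card V"] by blast
  have "k \<ge> 1" using k[OF \<open>L 1\<close>] .
  obtain xs where xs: "simple_path A xs" "set xs \<subseteq> V" "length xs = k"
    using \<open>L k\<close> unfolding L_def by blast
  then obtain v ys where v: "xs = v # ys" using \<open>k \<ge> 1\<close> by (cases xs) auto
  \<comment> \<open>The path is a longest one: a neighbour of its first vertex \<open>v\<close> off
    the path would lengthen it, and one beyond the second vertex would close a cycle. So
    \<open>v\<close> has at most one neighbour, and deleting \<open>v\<close> costs at most two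
    ordered pairs.\<close>
  have nb: "ys \<noteq> [] \<and> w = hd ys" if "(w, v) \<in> A" for w
  proof -
    have "w \<noteq> v" using that Suc.prems(5) by (auto simp: irrefl_def)
    have "w \<in> set ys"
    proof (rule ccontr)
      assume "w \<notin> set ys"
      then have "simple_path A (w # xs)" "set (w # xs) \<subseteq> V"
        using xs v that \<open>w \<noteq> v\<close> Suc.prems(3) by (auto simp: simple_path_def)
      then have "L (length (w # xs))" unfolding L_def by blast
      then show False using k[of "length (w # xs)"] xs by simp
    qed
    then obtain ys1 ys2 where ys: "ys = ys1 @ w # ys2" by (meson split_list)
    have "ys1 = []"
    proof (rule ccontr)
      assume "ys1 \<noteq> []"
      moreover have "simple_path A ((v # ys1 @ [w]) @ ys2)"
        using xs(1) unfolding v ys by simp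
      then have "simple_path A (v # ys1 @ [w])"
        unfolding simple_path_def successively_append_iff by auto
      ultimately have "closed_path A (v # ys1 @ [w])"
        using that by (cases ys1) (auto simp: closed_path_def)
      then show False using Suc.prems(6) by blast
    qed
    then show ?thesis using ys by simp
  qed
  define A' where "A' = A \<inter> (V - {v}) \<times> (V - {v})"
  have "v \<in> V" using xs v by simp
  have "A \<subseteq> A' \<union> {(v, hd ys), (hd ys, v)}"
    using nb Suc.prems(3,4) unfolding A'_def by (auto dest: symD)
  moreover have "finite A'" unfolding A'_def using Suc.prems(1) by auto
  ultimately have "card A \<le> card (A' \<union> {(v, hd ys), (hd ys, v)})"
    by (intro card_mono) auto
  also have "\<dots> \<le> card A' + card {(v, hd ys), (hd ys, v)}" by (rule card_Un_le)
  also have "\<dots> \<le> card A' + 2" by (cases "v = hd ys") auto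
  finally have le: "card A \<le> card A' + 2" .
  show ?case
  proof (cases "V = {v}")
    case True
    then have "A = {}"
      using Suc.prems(3,5) by (auto simp: irrefl_def)
    then show ?thesis using True by simp
  next
    case False
    have "card A' + 2 \<le> 2 * card (V - {v})"
    proof (rule Suc.hyps(1))
      show "n = card (V - {v})" using Suc.hyps(2) \<open>v \<in> V\<close> Suc.prems(1) by simp
      show "V - {v} \<noteq> {}" using False \<open>v \<in> V\<close> by auto
      show "sym A'" using Suc.prems(4) unfolding A'_def sym_def by auto
      show "irrefl A'" using Suc.prems(5) unfolding A'_def irrefl_def by auto
      show "\<not> closed_path A' c" for c
        using Suc.prems(6) closed_path_mono[of A' c A] unfolding A'_def by blast
    qed (use Suc.prems in \<open>auto simp: A'_def\<close>)
    moreover have "card V = Suc (card (V - {v}))"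
      using \<open>v \<in> V\<close> Suc.prems(1) by (metis card.remove)
    ultimately show ?thesis using le by simp
  qed
qed

text \<open>
  With \<open>n\<close> the number of cycles, a cactus has at most \<open>card V - 1 + n\<close> edges (each counted
  twice in \<open>A\<close>), and as the cycles are joined in a tree-like fashion the set \<open>Q\<close> has at least
  \<open>2 * n + 1\<close> elements.
\<close>
lemma cactus_edge_bound:
  assumes "finite V" "V \<noteq> {}" "A \<subseteq> V \<times> V" "sym A" "irrefl A" "finite Q"
    and "is_cactus V (\<lambda>u v. (u, v) \<in> A)"
    and "\<And>c. closed_path A c \<Longrightarrow> card (set c \<inter> Q) \<ge> 3"
  shows "card A + 3 \<le> 2 * card V + max 1 (card Q)"
  using assms
proof (induction "card A" arbitrary: A Q rule: less_induct)
  case less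
  have finA: "finite A" using less.prems(1,3) finite_subset by blast
  show ?case
  proof (cases "\<exists>c. closed_path A c")
    case False
    then have "card A + 2 \<le> 2 * card V"
      using acyclic_edge_bound less.prems by metis
    then show ?thesis by simp
  next
    case True
    then obtain c where c: "closed_path A c"
      and only: "\<And>d x. closed_path A d \<Longrightarrow> cycle_edges d \<noteq> cycle_edges c \<Longrightarrow> x \<in> set c \<Longrightarrow>
                   x \<in> set d \<Longrightarrow> x = last c"
      using cactus_end_cycle[OF less.prems(1,3,7)] by metis
    \<comment> \<open>The end cycle is opened at its closing edge, which removes two ordered pairs.
      In exchange two points of \<open>Q\<close> are given up, so both sides of the bound drop by
      two.\<close>
    define e where "e = {(last c, hd c), (hd c, last c)}"
    define A' where "A' = A - e"
    have "c \<noteq> []" "(last c, hd c) \<in> A" using c by (auto simp: closed_path_def)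
    have "e \<subseteq> A" using \<open>(last c, hd c) \<in> A\<close> less.prems(4) by (auto simp: e_def dest: symD)
    have "last c \<noteq> hd c" using \<open>(last c, hd c) \<in> A\<close> less.prems(5) by (auto simp: irrefl_def)
    then have "card e = 2" by (auto simp: e_def)
    have cA: "card A = card A' + 2"
      using card_Diff_subset[of e A] card_mono[OF finA \<open>e \<subseteq> A\<close>] \<open>e \<subseteq> A\<close> \<open>card e = 2\<close> finA finite_subset
      unfolding A'_def by fastforce
    have "card (set c \<inter> Q) \<ge> 3" using less.prems(8) c by blast
    moreover have "card (set c \<inter> Q) \<le> card (set c \<inter> Q - {last c}) + 1"
      using card_Un_le[of "set c \<inter> Q - {last c}" "{last c}"]
        card_mono[of "set c \<inter> Q - {last c} \<union> {last c}" "set c \<inter> Q"] by fastforce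
    ultimately have "2 \<le> card (set c \<inter> Q - {last c})" by linarith
    \<comment> \<open>The vertex \<open>last c\<close> is spared because other cycles may pass
      through it; two of the at least three points of \<open>Q\<close> on \<open>c\<close> are left
      to choose.\<close>
    then obtain q where q: "q \<subseteq> set c \<inter> Q - {last c}" "card q = 2"
      by (meson obtain_subset_with_card_n)
    then have "finite q" using card.infinite by force
    define Q' where "Q' = Q - q"
    have cQ: "card Q' = card Q - 2"
      unfolding Q'_def using q \<open>finite q\<close> by (subst card_Diff_subset) auto
    \<comment> \<open>Hence \<open>Q'\<close> is nonempty, and \<open>max 1\<close>, which serves
      the acyclic case, does not disturb the induction step.\<close>
    have "3 \<le> card Q"
      using \<open>card (set c \<inter> Q) \<ge> 3\<close> card_mono[of Q "set c \<inter> Q"] less.prems(6) by auto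
    have "A' \<subseteq> A" by (auto simp: A'_def)
    have "card A' + 3 \<le> 2 * card V + max 1 (card Q')"
    proof (rule less.hyps)
      show "card A' < card A" using cA by simp
      show "sym A'" using less.prems(4) unfolding A'_def e_def sym_def by auto
      show "irrefl A'" using less.prems(5) unfolding A'_def irrefl_def by auto
      show "is_cactus V (\<lambda>u v. (u, v) \<in> A')"
        by (rule is_cactus_mono[OF less.prems(7)]) (use \<open>A' \<subseteq> A\<close> in auto)
      show "card (set d \<inter> Q') \<ge> 3" if d: "closed_path A' d" for d
      proof -
        have dA: "closed_path A d" using d \<open>A' \<subseteq> A\<close> closed_path_mono by blast
        have "is_cycle V (\<lambda>u v. (u, v) \<in> A') d"
          using is_cycle_iff_closed_path[of A' V d] d \<open>A' \<subseteq> A\<close> less.prems(3) by blast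
        then have "{last c, hd c} \<notin> cycle_edges d"
          using cycle_edges_subset[of V A' d "last c" "hd c"] by (auto simp: A'_def e_def)
        then have "cycle_edges d \<noteq> cycle_edges c"
          using closing_edge_in_cycle_edges[OF \<open>c \<noteq> []\<close>] by auto
        \<comment> \<open>A cycle \<open>d\<close> avoiding the removed edge differs from
          \<open>c\<close>, so it meets \<open>c\<close> at most in \<open>last c\<close> and loses
          no point of \<open>Q\<close>.\<close>
        then have "set d \<inter> Q' = set d \<inter> Q"
          using only[OF dA] q(1) unfolding Q'_def by blast
        then show ?thesis using less.prems(8)[OF dA] by simp
      qed
    qed (use less.prems in \<open>auto simp: A'_def Q'_def\<close>)
    then show ?thesis using cA cQ \<open>3 \<le> card Q\<close> by simp
  qed
qed

section \<open>Colouring sparse linear families\<close>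

definition point_degree :: "point set set \<Rightarrow> point \<Rightarrow> nat" where
  "point_degree N p = card {s \<in> N. p \<in> s}"

text \<open>The segments viewed as a linear hypergraph; the colouring argument sees their geometry
  only through this property and sparsity.\<close>

definition linear_family :: "point set set \<Rightarrow> bool" where
  "linear_family N \<longleftrightarrow> finite N \<and>
     (\<forall>s\<in>N. \<forall>t\<in>N. \<forall>p q. s \<noteq> t \<and> p \<in> s \<inter> t \<and> q \<in> s \<inter> t \<longrightarrow> p = q)"

text \<open>This is the bound Sum d(p) <= |N| + 3/2 (|P(N)| - 1), multiplied by four and arranged
  without subtraction. A single segment has no intersection point and would violate it, hence
  \<open>card N \<ge> 2\<close>. Quantifying over subfamilies lets the induction delete
  segments.\<close>

definition sparse_family :: "point set set \<Rightarrow> bool" where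
  "sparse_family M \<longleftrightarrow> (\<forall>N\<subseteq>M. card N \<ge> 2 \<longrightarrow>
     4 * (\<Sum>p\<in>intersection_points N. point_degree N p) + 6
       \<le> 4 * card N + 6 * card (intersection_points N))"

lemma linear_familyD:
  "linear_family N \<Longrightarrow> s \<in> N \<Longrightarrow> t \<in> N \<Longrightarrow> s \<noteq> t \<Longrightarrow> p \<in> s \<Longrightarrow> p \<in> t \<Longrightarrow> q \<in> s \<Longrightarrow> q \<in> t \<Longrightarrow> p = q"
  unfolding linear_family_def by blast

lemma linear_family_finite: "linear_family N \<Longrightarrow> finite N"
  by (simp add: linear_family_def)

lemma linear_family_subset: "linear_family N \<Longrightarrow> N' \<subseteq> N \<Longrightarrow> linear_family N'"
  unfolding linear_family_def by (meson finite_subset subset_iff)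

lemma sparse_family_subset: "sparse_family N \<Longrightarrow> N' \<subseteq> N \<Longrightarrow> sparse_family N'"
  unfolding sparse_family_def by blast

lemma finite_intersection_points:
  assumes "linear_family N"
  shows "finite (intersection_points N)"
proof -
  have "intersection_points N \<subseteq> (\<Union>s\<in>N. \<Union>t\<in>N - {s}. s \<inter> t)"
    unfolding intersection_points_def by blast
  moreover have "finite (s \<inter> t)" if "s \<in> N" "t \<in> N - {s}" for s t
  proof (cases "s \<inter> t = {}")
    case False
    then obtain p where "p \<in> s \<inter> t" by blast
    then have "s \<inter> t \<subseteq> {p}"
      using linear_familyD[OF assms, of s t] that by blast
    then show ?thesis by (meson finite.emptyI finite_insert finite_subset)
  qed simp
  then have "finite (\<Union>s\<in>N. \<Union>t\<in>N - {s}. s \<inter> t)"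
    using linear_family_finite[OF assms] by (intro finite_UN_I) auto
  ultimately show ?thesis by (rule finite_subset)
qed

section \<open>Degrees, incidences and the sparsity bound\<close>

lemma intersection_points_iff_degree:
  assumes "finite N"
  shows "p \<in> intersection_points N \<longleftrightarrow> point_degree N p \<ge> 2"
proof
  assume "p \<in> intersection_points N"
  then obtain s t where st: "s \<in> N" "t \<in> N" "s \<noteq> t" "p \<in> s" "p \<in> t"
    unfolding intersection_points_def by blast
  then have "card {s, t} \<le> card {s \<in> N. p \<in> s}"
    using assms by (intro card_mono) auto
  then show "point_degree N p \<ge> 2" using st by (simp add: point_degree_def)
next
  assume "point_degree N p \<ge> 2"
  then obtain T where T: "T \<subseteq> {s \<in> N. p \<in> s}" "card T = 2"
    unfolding point_degree_def by (meson obtain_subset_with_card_n)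
  then obtain s t where "T = {s, t}" "s \<noteq> t" by (auto simp: card_2_iff)
  then show "p \<in> intersection_points N"
    using T unfolding intersection_points_def by blast
qed

text \<open>Deleting \<open>s\<close> lowers the degree by one exactly at the points of
  \<open>s\<close>, so the points lost are those dropping from degree two to one.\<close>

lemma intersection_points_remove:
  assumes "finite N" "s \<in> N"
  shows "intersection_points (N - {s}) = intersection_points N - {p \<in> s. point_degree N p = 2}"
proof -
  have "point_degree N p = point_degree (N - {s}) p + (if p \<in> s then 1 else 0)" for p
  proof (cases "p \<in> s")
    case True
    then have "{t \<in> N. p \<in> t} = insert s {t \<in> N - {s}. p \<in> t}" using assms by auto
    then show ?thesis using True assms by (simp add: point_degree_def)
  next
    case False
    then have "{t \<in> N. p \<in> t} = {t \<in> N - {s}. p \<in> t}" by auto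
    then show ?thesis using False by (simp add: point_degree_def)
  qed
  moreover have "finite (N - {s})" using assms by simp
  ultimately have "p \<in> intersection_points (N - {s}) \<longleftrightarrow>
      p \<in> intersection_points N - {p \<in> s. point_degree N p = 2}" for p
    using intersection_points_iff_degree[OF assms(1), of p]
      intersection_points_iff_degree[of "N - {s}" p] by (cases "p \<in> s") auto
  then show ?thesis by blast
qed

lemma sum_over_incidences:
  fixes g :: "point \<Rightarrow> nat"
  assumes "linear_family N"
  shows "(\<Sum>s\<in>N. \<Sum>p\<in>intersection_points N \<inter> s. g p)
           = (\<Sum>p\<in>intersection_points N. point_degree N p * g p)"
proof -
  have "(\<Sum>s\<in>N. \<Sum>p\<in>{p. p \<in> intersection_points N \<and> p \<in> s}. g p)
          = (\<Sum>p\<in>intersection_points N. \<Sum>s\<in>{s. s \<in> N \<and> p \<in> s}. g p)"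
    using assms finite_intersection_points linear_family_finite by (intro sum.swap_restrict) auto
  then show ?thesis by (simp add: Int_def point_degree_def)
qed

text \<open>The weights \<open>1\<close> and \<open>2\<close> are chosen such that \<open>d * weight \<le> 4 * d - 6\<close> for a point of degree \<open>d\<close>.\<close>
lemma sparse_family_weight_bound:
  assumes "linear_family N" "sparse_family N" "card N \<ge> 2"
  shows "(\<Sum>s\<in>N. card {p \<in> intersection_points N \<inter> s. point_degree N p = 2}
              + 2 * card {p \<in> intersection_points N \<inter> s. point_degree N p \<noteq> 2}) + 6 \<le> 4 * card N"
proof -
  let ?P = "intersection_points N" and ?d = "point_degree N"
  define wt :: "point \<Rightarrow> nat" where "wt p = (if ?d p = 2 then 1 else 2)" for p
  have finP: "finite ?P" using assms finite_intersection_points by blast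
  have "card {p \<in> ?P \<inter> s. ?d p = 2} + 2 * card {p \<in> ?P \<inter> s. ?d p \<noteq> 2} = (\<Sum>p\<in>?P \<inter> s. wt p)" for s
  proof -
    have "(\<Sum>p\<in>?P \<inter> s. wt p)
        = (\<Sum>p\<in>{p \<in> ?P \<inter> s. ?d p = 2} \<union> {p \<in> ?P \<inter> s. ?d p \<noteq> 2}. wt p)"
      by (rule sum.cong) auto
    also have "\<dots> = (\<Sum>p\<in>{p \<in> ?P \<inter> s. ?d p = 2}. wt p) + (\<Sum>p\<in>{p \<in> ?P \<inter> s. ?d p \<noteq> 2}. wt p)"
      using finP by (intro sum.union_disjoint) auto
    finally show ?thesis by (simp add: wt_def)
  qed
  then have "(\<Sum>s\<in>N. card {p \<in> ?P \<inter> s. ?d p = 2} + 2 * card {p \<in> ?P \<inter> s. ?d p \<noteq> 2})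
      = (\<Sum>p\<in>?P. ?d p * wt p)"
    using sum_over_incidences[OF assms(1), of wt] by simp
  moreover have "(\<Sum>p\<in>?P. ?d p * wt p + 6) \<le> (\<Sum>p\<in>?P. 4 * ?d p)"
  proof (rule sum_mono)
    fix p assume "p \<in> ?P"
    then have "?d p \<ge> 2"
      using assms intersection_points_iff_degree linear_family_finite by blast
    then show "?d p * wt p + 6 \<le> 4 * ?d p" by (auto simp: wt_def)
  qed
  then have "(\<Sum>p\<in>?P. ?d p * wt p) + 6 * card ?P \<le> 4 * (\<Sum>p\<in>?P. ?d p)"
    by (simp add: sum.distrib sum_distrib_left)
  moreover have "4 * (\<Sum>p\<in>?P. ?d p) + 6 \<le> 4 * card N + 6 * card ?P"
    using assms unfolding sparse_family_def by blast
  ultimately show ?thesis by linarith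
qed

lemma sum_degree_ge:
  assumes "linear_family N"
  shows "2 * card (intersection_points N) \<le> (\<Sum>p\<in>intersection_points N. point_degree N p)"
proof -
  have "(\<Sum>p\<in>intersection_points N. 2) \<le> (\<Sum>p\<in>intersection_points N. point_degree N p)"
    using assms intersection_points_iff_degree linear_family_finite by (intro sum_mono) blast
  then show ?thesis by simp
qed

text \<open>All degrees are at least two, so sparsity gives 2 |P| + 6 <= 4 |N|. This settles two
  segments, leaves the triangle as the only bad case of three, and is the bound that is tight for a
  full pair.\<close>

lemma card_intersection_points_le:
  assumes "linear_family N" "sparse_family N" "card N \<ge> 2"
  shows "card (intersection_points N) + 3 \<le> 2 * card N"
proof -
  have "4 * (\<Sum>p\<in>intersection_points N. point_degree N p) + 6
      \<le> 4 * card N + 6 * card (intersection_points N)"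
    using assms unfolding sparse_family_def by blast
  then show ?thesis using sum_degree_ge[OF assms(1)] by linarith
qed

section \<open>Points on a single segment\<close>

lemma points_on_segment:
  assumes "linear_family N" "t \<in> N"
  obtains h where "\<And>u. u \<in> N - {t} \<Longrightarrow> u \<inter> t \<noteq> {} \<Longrightarrow> h u \<in> u \<inter> t"
    and "intersection_points N \<inter> t = h ` {u \<in> N - {t}. u \<inter> t \<noteq> {}}"
proof
  \<comment> \<open>By linearity \<open>u\<close> and \<open>t\<close> share at most one point, so
    the choice is forced whenever they meet. Counting points on \<open>t\<close> thus becomes
    counting the image of the segments that meet \<open>t\<close>.\<close>
  define h where "h u = (SOME p. p \<in> u \<inter> t)" for u
  show h: "h u \<in> u \<inter> t" if "u \<in> N - {t}" "u \<inter> t \<noteq> {}" for u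
    using that(2) unfolding h_def by (intro someI_ex[of "\<lambda>p. p \<in> u \<inter> t"]) blast
  show "intersection_points N \<inter> t = h ` {u \<in> N - {t}. u \<inter> t \<noteq> {}}" (is "?L = ?R")
  proof
    show "?R \<subseteq> ?L" using h assms(2) unfolding intersection_points_def by blast
    show "?L \<subseteq> ?R"
    proof
      fix p assume p: "p \<in> ?L"
      then obtain u where u: "u \<in> N" "u \<noteq> t" "p \<in> u"
        unfolding intersection_points_def by blast
      then have "h u = p"
        using h[of u] p linear_familyD[OF assms(1) u(1) assms(2) u(2), of "h u" p] by blast
      then show "p \<in> ?R" using u p by blast
    qed
  qed
qed

lemma card_points_on_segment_le:
  assumes "linear_family N" "t \<in> N"
  shows "card (intersection_points N \<inter> t) \<le> card N - 1"
proof -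
  obtain h where "\<And>u. u \<in> N - {t} \<Longrightarrow> u \<inter> t \<noteq> {} \<Longrightarrow> h u \<in> u \<inter> t"
    and h: "intersection_points N \<inter> t = h ` {u \<in> N - {t}. u \<inter> t \<noteq> {}}"
    by (rule points_on_segment[OF assms]) blast
  have fin: "finite N" using assms linear_family_finite by blast
  have "card (h ` {u \<in> N - {t}. u \<inter> t \<noteq> {}}) \<le> card {u \<in> N - {t}. u \<inter> t \<noteq> {}}"
    using fin by (intro card_image_le) auto
  also have "\<dots> \<le> card (N - {t})" using fin by (intro card_mono) auto
  finally show ?thesis using h assms(2) by simp
qed

text \<open>Equality in the previous count forces every other segment to meet \<open>t\<close>, and
  no two of them in the same point of \<open>t\<close>.\<close>

lemma points_on_full_segment:
  assumes "linear_family N" "t \<in> N" "card (intersection_points N \<inter> t) = card N - 1"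
  obtains h where "\<And>u. u \<in> N - {t} \<Longrightarrow> h u \<in> u \<inter> t" and "inj_on h (N - {t})"
    and "intersection_points N \<inter> t = h ` (N - {t})"
proof -
  let ?T = "{u \<in> N - {t}. u \<inter> t \<noteq> {}}"
  obtain h where h: "\<And>u. u \<in> N - {t} \<Longrightarrow> u \<inter> t \<noteq> {} \<Longrightarrow> h u \<in> u \<inter> t"
    and P: "intersection_points N \<inter> t = h ` ?T"
    by (rule points_on_segment[OF assms(1,2)]) blast
  have fin: "finite N" using assms linear_family_finite by blast
  have le: "card (h ` ?T) \<le> card ?T" using fin by (intro card_image_le) auto
  have m: "card (h ` ?T) = card (N - {t})" using P assms(2,3) by simp
  have T: "?T = N - {t}"
    using fin le m by (intro card_seteq) auto
  have "inj_on h (N - {t})"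
    using T m fin by (intro eq_card_imp_inj_on) auto
  moreover have "h u \<in> u \<inter> t" if "u \<in> N - {t}" for u
    using h[OF that] that T by blast
  ultimately show thesis using that[of h] P unfolding T by simp
qed

section \<open>Constructing colourings\<close>

lemma EFL_coloring_mono: "EFL_coloring N k f \<Longrightarrow> k \<le> l \<Longrightarrow> EFL_coloring N l f"
  unfolding EFL_coloring_def by (fastforce simp: Pi_iff)

lemma EFL_coloring_few_points:
  assumes "linear_family N" "card (intersection_points N) \<le> k"
  obtains f where "EFL_coloring N k f"
proof -
  obtain f where "f ` intersection_points N \<subseteq> {1..k}" "inj_on f (intersection_points N)"
    using card_le_inj[of "intersection_points N" "{1..k}"] assms finite_intersection_points by auto
  then have "EFL_coloring N k f"
    unfolding EFL_coloring_def inj_on_def by blast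
  then show thesis by (rule that)
qed

text \<open>The points on the two full segments already exhaust the bound on the number of points:
  there are 2r + 1 of them, where r = |N| - 2. So each other segment \<open>u\<close> carries just
  two points, \<open>p u\<close> on \<open>t1\<close> and \<open>q u\<close> on
  \<open>t2\<close>.\<close>

lemma EFL_coloring_full_pair:
  assumes lin: "linear_family N" and P: "card (intersection_points N) + 3 \<le> 2 * card N"
    and m: "card N \<ge> 4" and t: "t1 \<in> N" "t2 \<in> N" "t1 \<noteq> t2"
    and full: "card (intersection_points N \<inter> t1) = card N - 1"
      "card (intersection_points N \<inter> t2) = card N - 1"
  obtains f where "EFL_coloring N (card N - 1) f"
proof -
  let ?P = "intersection_points N"
  define U where "U = N - {t1, t2}"
  define r where "r = card U"
  have fin: "finite N" using lin linear_family_finite by blast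
  have r: "card N = r + 2"
    unfolding r_def U_def using t fin m by (subst card_Diff_subset) auto
  have "r \<ge> 2" using r m by simp
  have finU: "finite U" unfolding U_def using fin by simp
  obtain p where p: "\<And>u. u \<in> N - {t1} \<Longrightarrow> p u \<in> u \<inter> t1" and pinj: "inj_on p (N - {t1})"
    and Pt1: "?P \<inter> t1 = p ` (N - {t1})"
    by (rule points_on_full_segment[OF lin t(1) full(1)]) blast
  obtain q where q: "\<And>u. u \<in> N - {t2} \<Longrightarrow> q u \<in> u \<inter> t2" and qinj: "inj_on q (N - {t2})"
    and Pt2: "?P \<inter> t2 = q ` (N - {t2})"
    by (rule points_on_full_segment[OF lin t(2) full(2)]) blast
  define v where "v = p t2"
  have v: "v \<in> t1" "v \<in> t2" using p[of t2] t by (auto simp: v_def)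
  have only_v: "x = v" if "x \<in> t1" "x \<in> t2" for x
    using linear_familyD[OF lin t(1,2,3)] that v by blast
  have "q t1 = v" using q[of t1] t only_v by blast
  have N1: "N - {t1} = insert t2 U" and N2: "N - {t2} = insert t1 U"
    using t by (auto simp: U_def)
  have pU: "p u \<in> u" "p u \<in> t1" and qU: "q u \<in> u" "q u \<in> t2" if "u \<in> U" for u
    using p[of u] q[of u] that by (auto simp: U_def)
  have pv: "p u \<noteq> v" if "u \<in> U" for u
    using pinj that t unfolding v_def inj_on_def U_def by blast
  have qv: "q u \<noteq> v" if "u \<in> U" for u
    using qinj that t unfolding \<open>q t1 = v\<close>[symmetric] inj_on_def U_def by blast
  have pq: "p u \<noteq> q u'" if "u \<in> U" "u' \<in> U" for u u'
    using only_v[of "p u"] pU[OF that(1)] qU[OF that(2)] pv[OF that(1)] by auto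
  have injU: "inj_on p U" "inj_on q U"
    using pinj qinj inj_on_subset unfolding N1 N2 by blast+
  have on_t1: "?P \<inter> t1 = insert v (p ` U)" using Pt1 unfolding N1 v_def by simp
  have on_t2: "?P \<inter> t2 = insert v (q ` U)" using Pt2 \<open>q t1 = v\<close> unfolding N2 by simp
  have sub: "insert v (p ` U \<union> q ` U) \<subseteq> ?P"
    using on_t1 on_t2 by blast
  have "card (p ` U \<union> q ` U) = r + r"
    using pq finU injU by (subst card_Un_disjoint) (auto simp: card_image r_def)
  moreover have "v \<notin> p ` U \<union> q ` U" using pv qv by blast
  ultimately have "card (insert v (p ` U \<union> q ` U)) = 2 * r + 1"
    using finU by simp
  then have P_eq: "insert v (p ` U \<union> q ` U) = ?P"
    using P r sub finite_intersection_points[OF lin] by (intro card_seteq) auto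
  obtain e where e: "bij_betw e U {0..<r}"
    using ex_bij_betw_finite_nat[OF finU] unfolding r_def by blast
  have er: "e u < r" if "u \<in> U" for u using e that by (auto simp: bij_betw_def)
  have einj: "u = u'" if "u \<in> U" "u' \<in> U" "e u = e u'" for u u'
    using e that by (auto simp: bij_betw_def inj_on_def)
  \<comment> \<open>The common point \<open>v\<close> gets the extra colour r + 1. The points
    \<open>p u\<close> use each of 1..r once, and the points \<open>q u\<close> use the same colours
    shifted cyclically by one.\<close>
  define f where "f x = (if x = v then r + 1 else if x \<in> p ` U then e (inv_into U p x) + 1
      else (e (inv_into U q x) + 1) mod r + 1)" for x
  have fv: "f v = r + 1" by (simp add: f_def)
  have fp: "f (p u) = e u + 1" if "u \<in> U" for u
    using that pv injU by (auto simp: f_def)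
  have fq: "f (q u) = (e u + 1) mod r + 1" if "u \<in> U" for u
  proof -
    have "q u \<notin> p ` U" using pq that by fastforce
    then show ?thesis using that qv injU by (auto simp: f_def)
  qed
  have modr: "Suc i mod r = (if Suc i = r then 0 else Suc i)" if "i < r" for i
    using that by auto
  have "f x \<in> {1..card N - 1}" if "x \<in> ?P" for x
  proof -
    consider "x = v" | u where "u \<in> U" "x = p u" | u where "u \<in> U" "x = q u"
      using \<open>x \<in> ?P\<close> unfolding P_eq[symmetric] by blast
    then show ?thesis
    proof cases
      case (2 u)
      then show ?thesis using er[of u] r fp[of u] by simp
    next
      case (3 u)
      have "(e u + 1) mod r < r" using \<open>r \<ge> 2\<close> by simp
      then show ?thesis using 3 r fq[of u] by simp
    qed (use r fv in simp)
  qed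
  moreover have "inj_on f (?P \<inter> s)" if s: "s \<in> N" for s
  proof -
    consider "s = t1" | "s = t2" | "s \<in> U" using s by (auto simp: U_def)
    then show ?thesis
    proof cases
      case 1
      then show ?thesis
        using on_t1 er by (auto simp: inj_on_def fv fp dest: einj)
    next
      case 2
      have "inj_on f (insert v (q ` U))"
      proof (rule inj_onI)
        fix x y assume "x \<in> insert v (q ` U)" "y \<in> insert v (q ` U)" and xy: "f x = f y"
        moreover have "(e u + 1) mod r < r" for u using \<open>r \<ge> 2\<close> by simp
        then have "(e u + 1) mod r \<noteq> r" "r \<noteq> (e u + 1) mod r" for u by (metis less_irrefl)+
        ultimately consider "x = y" | u u' where "u \<in> U" "u' \<in> U" "x = q u" "y = q u'"
          using fv fq by auto
        then show "x = y"
        proof cases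
          case (2 u u')
          then have "(e u + 1) mod r = (e u' + 1) mod r" using xy fq by simp
          then have "e u = e u'"
            using er[OF 2(1)] er[OF 2(2)] by (simp add: modr split: if_splits)
          then show ?thesis using einj 2 by blast
        qed simp
      qed
      then show ?thesis using on_t2 2 by simp
    next
      case 3
      have "s \<noteq> t1" "s \<noteq> t2" using 3 by (auto simp: U_def)
      have "x = p s \<or> x = q s" if "x \<in> ?P \<inter> s" for x
      proof -
        have "x = p s" if "x \<in> t1"
          using linear_familyD[OF lin s t(1) \<open>s \<noteq> t1\<close>, of x "p s"] pU[OF 3] that \<open>x \<in> ?P \<inter> s\<close> by blast
        moreover have "x = q s" if "x \<in> t2"
          using linear_familyD[OF lin s t(2) \<open>s \<noteq> t2\<close>, of x "q s"] qU[OF 3] that \<open>x \<in> ?P \<inter> s\<close> by blast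
        moreover have "x \<in> t1 \<or> x \<in> t2"
          using that pU qU v unfolding P_eq[symmetric] by blast
        ultimately show ?thesis by blast
      qed
      \<comment> \<open>A cyclic shift of at least two colours has no fixed point.\<close>
      moreover have "f (p s) \<noteq> f (q s)"
        using er[OF 3] \<open>r \<ge> 2\<close> by (auto simp: fp[OF 3] fq[OF 3] modr)
      ultimately show ?thesis unfolding inj_on_def by metis
    qed
  qed
  ultimately have "EFL_coloring N (card N - 1) f"
    unfolding EFL_coloring_def inj_on_def by blast
  then show thesis by (rule that)
qed

text \<open>At most one point of \<open>s\<close> survives the deletion of \<open>s\<close>, so two
  points of \<open>s\<close> never both rely on \<open>g\<close>. Surviving points on any other
  segment are already separated by \<open>g\<close>. What remains are pairs involving
  \<open>D\<close>, and the conditions on \<open>c\<close> deal with those.\<close>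

lemma EFL_coloring_extend:
  assumes fin: "finite N" and s: "s \<in> N"
    and D: "D = {p \<in> intersection_points N \<inter> s. point_degree N p = 2}"
    and one: "card {p \<in> intersection_points N \<inter> s. point_degree N p \<noteq> 2} \<le> 1"
    and finP: "finite (intersection_points N)"
    and g: "EFL_coloring (N - {s}) k g"
    and c: "\<And>p. p \<in> D \<Longrightarrow> c p \<in> {1..k}" "inj_on c D"
      "\<And>p q t. p \<in> D \<Longrightarrow> q \<in> intersection_points (N - {s}) \<Longrightarrow> t \<in> N \<Longrightarrow> p \<in> t \<Longrightarrow> q \<in> t \<Longrightarrow> c p \<noteq> g q"
  obtains f where "EFL_coloring N k f"
proof -
  let ?P = "intersection_points N"
  define f where "f p = (if p \<in> D then c p else g p)" for p
  have P': "intersection_points (N - {s}) = ?P - D"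
    using intersection_points_remove[OF fin s] D by blast
  have range: "f p \<in> {1..k}" if "p \<in> ?P" for p
    using that c(1) g P' unfolding EFL_coloring_def f_def by (auto simp: Pi_iff)
  have "f p \<noteq> f q" if "t \<in> N" "p \<in> ?P \<inter> t" "q \<in> ?P \<inter> t" "p \<noteq> q" for t p q
  proof -
    consider "p \<in> D" "q \<in> D" | "p \<in> D" "q \<notin> D" | "p \<notin> D" "q \<in> D" | "p \<notin> D" "q \<notin> D" by blast
    then show ?thesis
    proof cases
      case 1
      then show ?thesis using c(2) \<open>p \<noteq> q\<close> by (auto simp: f_def inj_on_def)
    next
      case 2
      then show ?thesis using c(3)[of p q t] P' that by (auto simp: f_def)
    next
      case 3
      then show ?thesis using c(3)[of q p t] P' that by (force simp: f_def)
    next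
      case 4
      have "t \<noteq> s"
      proof
        assume "t = s"
        then have "p \<in> {p \<in> ?P \<inter> s. point_degree N p \<noteq> 2}" "q \<in> {p \<in> ?P \<inter> s. point_degree N p \<noteq> 2}"
          using that 4 D by auto
        then show False
          using one \<open>p \<noteq> q\<close> finP by (auto simp: card_le_Suc0_iff_eq)
      qed
      then show ?thesis
        using g 4 that P' unfolding EFL_coloring_def f_def by auto
    qed
  qed
  with range have "EFL_coloring N k f" unfolding EFL_coloring_def by blast
  then show thesis by (rule that)
qed

section \<open>The induction on the number of segments\<close>

lemma degree_two_other_segment:
  assumes "s \<in> N" "p \<in> s" "point_degree N p = 2"
  shows "\<exists>t. t \<in> N \<and> t \<noteq> s \<and> p \<in> t \<and> (\<forall>u\<in>N. p \<in> u \<longrightarrow> u = s \<or> u = t)"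
proof -
  obtain a b where ab: "{t \<in> N. p \<in> t} = {a, b}" "a \<noteq> b"
    using assms(3) unfolding point_degree_def card_2_iff by blast
  then have "s = a \<or> s = b" using assms by blast
  then show ?thesis using ab by blast
qed

lemma free_color:
  fixes X :: "nat set"
  assumes "finite X" "card X < k"
  obtains c where "c \<in> {1..k}" "c \<notin> X"
proof -
  have "\<not> {1..k} \<subseteq> X" using card_mono[OF assms(1), of "{1..k}"] assms(2) by auto
  then show thesis using that by blast
qed

lemma sum_ge_with_exceptions:
  fixes w :: "'a \<Rightarrow> nat"
  assumes "finite N" "T \<subseteq> N" "\<And>t. t \<in> T \<Longrightarrow> a \<le> w t" "\<And>t. t \<in> N \<Longrightarrow> b \<le> w t"
  shows "card T * a + (card N - card T) * b \<le> sum w N"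
proof -
  have "card T * a \<le> sum w T"
    using sum_bounded_below[of T a w] assms(3) by simp
  moreover have "card (N - T) * b \<le> sum w (N - T)"
    using sum_bounded_below[of "N - T" b w] assms(4) by simp
  moreover have "sum w N = sum w (N - T) + sum w T"
    using assms by (intro sum.subset_diff) auto
  moreover have "card (N - T) = card N - card T"
    using assms finite_subset by (intro card_Diff_subset) auto
  ultimately show ?thesis by simp
qed

text \<open>Each of the three segments has at most two points, and the incidences number at least 2
  * 3 = 6, so equality holds throughout.\<close>

lemma triangle_points_on_segment:
  assumes "linear_family N" "sparse_family N" "card N = 3" "card (intersection_points N) = 3" "t \<in> N"
  shows "card (intersection_points N \<inter> t) = 2"
proof (rule ccontr)
  assume ne: "card (intersection_points N \<inter> t) \<noteq> 2"
  have le: "card (intersection_points N \<inter> u) \<le> 2" if "u \<in> N" for u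
    using card_points_on_segment_le[OF assms(1) that] assms(3) by simp
  have "(\<Sum>u\<in>N. card (intersection_points N \<inter> u)) < (\<Sum>u\<in>N. 2)"
    using le ne assms(1,5) linear_family_finite
    by (intro sum_strict_mono_ex1) (auto simp: order.strict_iff_order)
  moreover have "(\<Sum>u\<in>N. card (intersection_points N \<inter> u))
      = (\<Sum>p\<in>intersection_points N. point_degree N p)"
    using sum_over_incidences[OF assms(1), of "\<lambda>_. 1"] by simp
  ultimately show False
    using sum_degree_ge[OF assms(1)] assms(3,4) by simp
qed

lemma sparse_family_coloring:
  assumes "linear_family N" "sparse_family N"
    and "\<not> (card N = 3 \<and> card (intersection_points N) = 3)"
  shows "\<exists>f. EFL_coloring N (card N - 1) f"
  using assms
proof (induction "card N" arbitrary: N rule: less_induct)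
  case less
  let ?P = "intersection_points N" and ?d = "point_degree N"
  define m where "m = card N"
  note lin = less.prems(1) and sparse = less.prems(2)
  have fin: "finite N" using lin linear_family_finite by blast
  have finP: "finite ?P" using lin finite_intersection_points by blast
  consider "m \<le> 1" | "m = 2" | "m = 3" | "m \<ge> 4" by linarith
  then show ?case
  proof cases
    case 1
    have "?P = {}"
    proof (rule ccontr)
      assume "?P \<noteq> {}"
      then obtain p where "2 \<le> ?d p" using intersection_points_iff_degree[OF fin] by blast
      also have "?d p \<le> card N" unfolding point_degree_def using fin by (intro card_mono) auto
      finally show False using 1 m_def by simp
    qed
    then show ?thesis using EFL_coloring_few_points[OF lin, of "card N - 1"] by auto
  next
    case 2
    then have "card ?P \<le> card N - 1"
      using card_intersection_points_le[OF lin sparse] m_def by simp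
    then show ?thesis using EFL_coloring_few_points[OF lin] by blast
  next
    case 3
    then have "card ?P \<le> card N - 1"
      using card_intersection_points_le[OF lin sparse] less.prems(3) m_def by simp
    then show ?thesis using EFL_coloring_few_points[OF lin] by blast
  next
    case 4
    define n where "n t = card (?P \<inter> t)" for t
    have n_le: "n t \<le> m - 1" if "t \<in> N" for t
      using card_points_on_segment_le[OF lin that] by (simp add: n_def m_def)
    show ?thesis
    proof (cases "\<exists>t1\<in>N. \<exists>t2\<in>N. t1 \<noteq> t2 \<and> n t1 = m - 1 \<and> n t2 = m - 1")
      case True
      then obtain t1 t2 where "t1 \<in> N" "t2 \<in> N" "t1 \<noteq> t2" "n t1 = m - 1" "n t2 = m - 1" by blast
      moreover have "card ?P + 3 \<le> 2 * card N"
        using card_intersection_points_le[OF lin sparse] 4 m_def by simp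
      ultimately obtain f where "EFL_coloring N (card N - 1) f"
        by (elim EFL_coloring_full_pair[OF lin, of t1 t2]) (use 4 in \<open>simp_all add: n_def m_def\<close>)
      then show ?thesis by blast
    next
      case False
      then have no_full_pair: "n t1 < m - 1 \<or> n t2 < m - 1"
        if "t1 \<in> N" "t2 \<in> N" "t1 \<noteq> t2" for t1 t2
        using that n_le by (metis le_neq_implies_less)
      define w where "w s = card {p \<in> ?P \<inter> s. ?d p = 2} + 2 * card {p \<in> ?P \<inter> s. ?d p \<noteq> 2}" for s
      have w_sum: "sum w N + 6 \<le> 4 * m"
        using sparse_family_weight_bound[OF lin sparse] 4 unfolding w_def m_def by simp
      have "N \<noteq> {}" using 4 m_def by auto
      then have "\<exists>s\<in>N. \<forall>t\<in>N. w s \<le> w t"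
        using arg_min_if_finite[OF fin, of w] by (meson leI)
      then obtain s where s: "s \<in> N" and w_min: "\<And>t. t \<in> N \<Longrightarrow> w s \<le> w t" by blast
      \<comment> \<open>The minimal weight is at most the average, which is below four. Weight at
        most three allows only one point of degree at least three on \<open>s\<close>.\<close>
      have w_le: "m * w s + 6 \<le> 4 * m"
        using sum_bounded_below[of N "w s" w] w_min w_sum m_def by simp
      have "w s \<le> 3"
      proof (rule ccontr)
        assume "\<not> w s \<le> 3"
        then have "m * 4 \<le> m * w s" by simp
        then show False using w_le by linarith
      qed
      define D where "D = {p \<in> ?P \<inter> s. ?d p = 2}"
      define B where "B = {p \<in> ?P \<inter> s. ?d p \<noteq> 2}"
      have ws: "w s = card D + 2 * card B" by (simp add: w_def D_def B_def)
      have cB: "card B \<le> 1" using ws \<open>w s \<le> 3\<close> by simp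
      have finD: "finite D" and finB: "finite B" using finP by (auto simp: D_def B_def)
      have P': "intersection_points (N - {s}) = ?P - D"
        using intersection_points_remove[OF fin s] unfolding D_def by blast
      have card': "card (N - {s}) = m - 1" using s fin m_def by simp
      have lin': "linear_family (N - {s})" and sparse': "sparse_family (N - {s})"
        by (rule linear_family_subset[OF lin Diff_subset] sparse_family_subset[OF sparse Diff_subset])+
      define tri where "tri \<longleftrightarrow> card (N - {s}) = 3 \<and> card (?P - D) = 3"
      have IH: "\<exists>g. EFL_coloring (N - {s}) (m - 2) g" if "\<not> tri"
      proof -
        have "card (N - {s}) < card N" "card (N - {s}) - 1 = m - 2" using card' 4 m_def by simp_all
        moreover have "\<not> (card (N - {s}) = 3 \<and> card (intersection_points (N - {s})) = 3)"
          using that P' tri_def by simp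
        ultimately show ?thesis using less.hyps[OF _ lin' sparse'] by metis
      qed
      have tri4: "m = 4 \<and> w s \<le> 2" if tri
      proof -
        have "m = 4" using that card' 4 unfolding tri_def by linarith
        then show ?thesis using w_le by simp
      qed
      have g_ex: "\<exists>g. EFL_coloring (N - {s}) (m - 1) g"
      proof (cases tri)
        case True
        then have "card (intersection_points (N - {s})) \<le> m - 1"
          using tri4 P' unfolding tri_def by simp
        then show ?thesis using EFL_coloring_few_points[OF lin'] by blast
      next
        case False
        then obtain g where "EFL_coloring (N - {s}) (m - 2) g" using IH by blast
        then have "EFL_coloring (N - {s}) (m - 1) g" by (rule EFL_coloring_mono) simp
        then show ?thesis by blast
      qed
      have "\<forall>p\<in>D. \<exists>t. t \<in> N \<and> t \<noteq> s \<and> p \<in> t \<and> (\<forall>u\<in>N. p \<in> u \<longrightarrow> u = s \<or> u = t)"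
        using degree_two_other_segment[OF s] unfolding D_def by blast
      from bchoice[OF this] obtain \<tau> where "\<forall>p\<in>D. \<tau> p \<in> N \<and> \<tau> p \<noteq> s \<and> p \<in> \<tau> p \<and>
          (\<forall>u\<in>N. p \<in> u \<longrightarrow> u = s \<or> u = \<tau> p)" ..
      then have \<tau>: "\<tau> p \<in> N" "\<tau> p \<noteq> s" "p \<in> \<tau> p" "u \<in> N \<Longrightarrow> p \<in> u \<Longrightarrow> u = s \<or> u = \<tau> p"
        if "p \<in> D" for p u using that by blast+
      have \<tau>_inj: "p = q" if "p \<in> D" "q \<in> D" "\<tau> p = \<tau> q" for p q
        using linear_familyD[OF lin \<tau>(1)[OF that(1)] s \<tau>(2)[OF that(1)], of p q] that \<tau>(3) D_def by auto
      \<comment> \<open>A lost point \<open>p\<close> lies only on \<open>s\<close> and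
        \<open>\<tau> p\<close>, so a surviving point can clash with it only there.\<close>
      have conflict: "q \<in> B \<or> q \<in> ?P \<inter> \<tau> p - {p}"
        if "p \<in> D" "q \<in> intersection_points (N - {s})" "u \<in> N" "p \<in> u" "q \<in> u" for p q u
        using \<tau>(4)[OF that(1,3,4)] that P' unfolding D_def B_def by auto
      have forbidden: "card (g ` (?P \<inter> \<tau> p - {p})) \<le> n (\<tau> p) - 1" if "p \<in> D" for p and g :: "point \<Rightarrow> nat"
      proof -
        have "card (g ` (?P \<inter> \<tau> p - {p})) \<le> card (?P \<inter> \<tau> p - {p})"
          using finP by (intro card_image_le) auto
        also have "\<dots> = n (\<tau> p) - 1"
          using that \<tau>(3)[OF that] unfolding D_def n_def by simp
        finally show ?thesis .
      qed
      note extend = EFL_coloring_extend[OF fin s D_def cB[unfolded B_def] finP]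
      have "card D \<le> 3" using ws \<open>w s \<le> 3\<close> by simp
      then consider "card D = 0" | "card D = 1" | "card D = 2" | "card D = 3" by linarith
      then show ?thesis
      proof cases
        case 1
        then have "D = {}" using finD by simp
        obtain g where g: "EFL_coloring (N - {s}) (m - 1) g" using g_ex by blast
        obtain f where "EFL_coloring N (m - 1) f"
          by (rule extend[OF g, of "\<lambda>_. 0"]) (use \<open>D = {}\<close> in auto)
        then show ?thesis unfolding m_def by blast
      next
        case 2
        then obtain p where D: "D = {p}" using card_1_singletonE by blast
        then have p: "p \<in> D" by simp
        show ?thesis
        proof (cases tri)
          case True
          have "card B = 0" using ws tri4[OF True] 2 by linarith
          then have "B = {}" using finB by simp
          obtain g where g: "EFL_coloring (N - {s}) (m - 1) g" using g_ex by blast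
          \<comment> \<open>The triangle is coloured with all m - 1 colours, so no colour is new;
            but \<open>\<tau> p\<close> forbids at most m - 2 of them and \<open>s\<close> forbids
            none.\<close>
          have lt: "card (g ` (?P \<inter> \<tau> p - {p})) < m - 1"
            using forbidden[OF p, of g] n_le[OF \<tau>(1)[OF p]] 4 by linarith
          obtain c where c: "c \<in> {1..m - 1}" "c \<notin> g ` (?P \<inter> \<tau> p - {p})"
            by (rule free_color[OF _ lt]) (use finP in auto)
          obtain f where "EFL_coloring N (m - 1) f"
          proof (rule extend[OF g, of "\<lambda>_. c"])
            show "c \<noteq> g y" if "x \<in> D" "y \<in> intersection_points (N - {s})" "u \<in> N" "x \<in> u" "y \<in> u" for x y u
              using conflict[OF that] that(1) \<open>B = {}\<close> c(2) D by auto
          qed (use c D in auto)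
          then show ?thesis unfolding m_def by blast
        next
          case False
          then obtain g where g: "EFL_coloring (N - {s}) (m - 2) g" using IH by blast
          then have g1: "EFL_coloring (N - {s}) (m - 1) g" by (rule EFL_coloring_mono) simp
          have gq: "g q \<noteq> m - 1" if "q \<in> intersection_points (N - {s})" for q
            using g that 4 unfolding EFL_coloring_def by (fastforce simp: Pi_iff)
          obtain f where "EFL_coloring N (m - 1) f"
          \<comment> \<open>Here \<open>g\<close> uses only m - 2 colours, so m - 1 is new and
            clashes with nothing.\<close>
          proof (rule extend[OF g1, of "\<lambda>_. m - 1"])
            show "m - 1 \<noteq> g y" if "x \<in> D" "y \<in> intersection_points (N - {s})" "u \<in> N" "x \<in> u" "y \<in> u" for x y u
              using gq[OF that(2)] by (rule not_sym)
          qed (use D 4 in auto)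
          then show ?thesis unfolding m_def by blast
        qed
      next
        case 3
        have "card B = 0" using ws \<open>w s \<le> 3\<close> 3 by linarith
        then have "B = {}" using finB by simp
        obtain p0 q0 where D0: "D = {p0, q0}" "p0 \<noteq> q0" using 3 by (auto simp: card_2_iff)
        then have "n (\<tau> p0) < m - 1 \<or> n (\<tau> q0) < m - 1"
          using no_full_pair[of "\<tau> p0" "\<tau> q0"] \<tau>(1) \<tau>_inj by blast
        then obtain p q where D: "D = {p, q}" "p \<noteq> q" and np: "n (\<tau> p) < m - 1"
          using D0 by (metis insert_commute)
        \<comment> \<open>Over a triangle, both \<open>\<tau> p\<close> and \<open>\<tau> q\<close>
          would carry two triangle points and a lost one, which is m - 1 = 3 points each: a full
          pair.\<close>
        have "\<not> tri"
        proof
          assume tri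
          have "m - 1 \<le> n (\<tau> x)" if "x \<in> D" for x
          proof -
            have "card (intersection_points (N - {s}) \<inter> \<tau> x) = 2"
              using triangle_points_on_segment[OF lin' sparse'] \<open>tri\<close> P' \<tau>(1,2)[OF that]
              unfolding tri_def by simp
            moreover have "insert x (intersection_points (N - {s}) \<inter> \<tau> x) \<subseteq> ?P \<inter> \<tau> x"
              using P' that \<tau>(3)[OF that] unfolding D_def by auto
            then have "card (insert x (intersection_points (N - {s}) \<inter> \<tau> x)) \<le> n (\<tau> x)"
              unfolding n_def using finP by (intro card_mono) auto
            moreover have "x \<notin> intersection_points (N - {s})" using P' that by simp
            ultimately show ?thesis using tri4[OF \<open>tri\<close>] finP P' by simp
          qed
          then show False using np D(1) by (metis insertI1 leD)
        qed
        then obtain g where g: "EFL_coloring (N - {s}) (m - 2) g" using IH by blast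
        then have g1: "EFL_coloring (N - {s}) (m - 1) g" by (rule EFL_coloring_mono) simp
        have gq: "g x \<noteq> m - 1" if "x \<in> intersection_points (N - {s})" for x
          using g that 4 unfolding EFL_coloring_def by (fastforce simp: Pi_iff)
        have p: "p \<in> D" using D by simp
        have lt: "card (g ` (?P \<inter> \<tau> p - {p})) < m - 2"
          using forbidden[OF p, of g] np 4 by linarith
        obtain c where c: "c \<in> {1..m - 2}" "c \<notin> g ` (?P \<inter> \<tau> p - {p})"
          by (rule free_color[OF _ lt]) (use finP in auto)
        \<comment> \<open>One lost point takes the new colour m - 1. The other, on the segment that
          is not full, finds an old colour, since fewer than m - 2 are forbidden.\<close>
        define col where "col x = (if x = p then c else m - 1)" for x
        obtain f where "EFL_coloring N (m - 1) f"
        proof (rule extend[OF g1, of col])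
          show "inj_on col D" using D c 4 by (auto simp: col_def)
          show "col x \<in> {1..m - 1}" if "x \<in> D" for x using c 4 by (auto simp: col_def)
          show "col x \<noteq> g y" if "x \<in> D" "y \<in> intersection_points (N - {s})" "u \<in> N" "x \<in> u" "y \<in> u" for x y u
          proof (cases "x = p")
            case True
            then show ?thesis using conflict[OF that] \<open>B = {}\<close> c by (auto simp: col_def)
          next
            case False
            then have "col x = m - 1" by (simp add: col_def)
            then show ?thesis using gq[OF that(2)] by metis
          qed
        qed blast
        then show ?thesis unfolding m_def by blast
      next
        case 4
        have "card B = 0" and "w s = 3" using ws \<open>w s \<le> 3\<close> 4 by linarith+
        then have "B = {}" using finB by simp
        \<comment> \<open>Minimal weight three means 3m + 6 <= 4m.\<close>
        have "m \<ge> 6" using w_le \<open>w s = 3\<close> by simp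
        have "\<not> tri" using tri4 \<open>w s = 3\<close> by auto
        obtain p where p: "p \<in> D" and p_min: "\<And>x. x \<in> D \<Longrightarrow> n (\<tau> p) \<le> n (\<tau> x)"
          proof -
          have "D \<noteq> {}" using 4 by auto
          then have "\<exists>x\<in>D. \<forall>y\<in>D. n (\<tau> x) \<le> n (\<tau> y)"
            using arg_min_if_finite[OF finD, of "\<lambda>x. n (\<tau> x)"] by (meson leI)
          then show thesis using that by blast
        qed
        have "card (D - {p}) = 2" using p 4 finD by simp
        then obtain q0 r0 where D0: "D - {p} = {q0, r0}" "q0 \<noteq> r0" by (auto simp: card_2_iff)
        have "n (\<tau> q0) < m - 1 \<or> n (\<tau> r0) < m - 1"
          using no_full_pair[of "\<tau> q0" "\<tau> r0"] \<tau>(1) \<tau>_inj D0 by blast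
        then obtain q r where "D - {p} = {q, r}" "q \<noteq> r" and nq: "n (\<tau> q) < m - 1"
          using D0 by (metis insert_commute)
        then have D: "D = {p, q, r}" "p \<noteq> q" "p \<noteq> r" "q \<noteq> r" using p by blast+
        \<comment> \<open>Otherwise three segments have weight at least m - 2 and the other m - 3
          have weight at least three. The total 6m - 15 would exceed 4m - 6, since m is at least
          six.\<close>
        have np: "n (\<tau> p) < m - 2"
        proof (rule ccontr)
          assume "\<not> n (\<tau> p) < m - 2"
          then have big: "m - 2 \<le> n (\<tau> x)" if "x \<in> D" for x using p_min[OF that] by simp
          have n_w: "n t \<le> w t" for t
          proof -
            have "n t = card ({p \<in> ?P \<inter> t. ?d p = 2} \<union> {p \<in> ?P \<inter> t. ?d p \<noteq> 2})"
              unfolding n_def by (rule arg_cong[where f = card]) auto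
            also have "\<dots> \<le> card {p \<in> ?P \<inter> t. ?d p = 2} + card {p \<in> ?P \<inter> t. ?d p \<noteq> 2}"
              by (rule card_Un_le)
            finally show ?thesis by (simp add: w_def)
          qed
          have "card (\<tau> ` D) = 3" using 4 \<tau>_inj by (subst card_image) (auto simp: inj_on_def)
          moreover have "card (\<tau> ` D) * (m - 2) + (card N - card (\<tau> ` D)) * 3 \<le> sum w N"
          proof (rule sum_ge_with_exceptions[OF fin])
            show "\<tau> ` D \<subseteq> N" using \<tau>(1) by blast
            show "m - 2 \<le> w t" if "t \<in> \<tau> ` D" for t
              using that big n_w le_trans by blast
            show "3 \<le> w t" if "t \<in> N" for t using w_min[OF that] \<open>w s = 3\<close> by simp
          qed
          ultimately show False using w_sum \<open>m \<ge> 6\<close> m_def by simp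
        qed
        obtain g where g: "EFL_coloring (N - {s}) (m - 2) g" using IH \<open>\<not> tri\<close> by blast
        then have g1: "EFL_coloring (N - {s}) (m - 1) g" by (rule EFL_coloring_mono) simp
        have gq: "g x \<noteq> m - 1" if "x \<in> intersection_points (N - {s})" for x
          using g that \<open>m \<ge> 6\<close> unfolding EFL_coloring_def by (fastforce simp: Pi_iff)
        have q: "q \<in> D" using D by simp
        have lt: "card (g ` (?P \<inter> \<tau> q - {q})) < m - 2"
          using forbidden[OF q, of g] nq \<open>m \<ge> 6\<close> by linarith
        obtain c where c: "c \<in> {1..m - 2}" "c \<notin> g ` (?P \<inter> \<tau> q - {q})"
          by (rule free_color[OF _ lt]) (use finP in auto)
        have "card (insert c (g ` (?P \<inter> \<tau> p - {p}))) \<le> Suc (card (g ` (?P \<inter> \<tau> p - {p})))"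
          by (rule card_insert_le_m1) auto
        also have "\<dots> < m - 2"
          using forbidden[OF p, of g] np \<open>m \<ge> 6\<close> by linarith
        finally have lt': "card (insert c (g ` (?P \<inter> \<tau> p - {p}))) < m - 2" .
        obtain c' where c': "c' \<in> {1..m - 2}" "c' \<notin> insert c (g ` (?P \<inter> \<tau> p - {p}))"
          by (rule free_color[OF _ lt']) (use finP in auto)
        \<comment> \<open>Two lost points take old colours and \<open>r\<close> the new one. The
          colour of \<open>q\<close> is chosen first; \<open>p\<close> must also avoid it, which is
          why \<open>\<tau> p\<close> needs the stronger bound.\<close>
        define col where "col x = (if x = p then c' else if x = q then c else m - 1)" for x
        obtain f where "EFL_coloring N (m - 1) f"
        proof (rule extend[OF g1, of col])
          show "inj_on col D" using D c c' \<open>m \<ge> 6\<close> by (auto simp: col_def)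
          show "col x \<in> {1..m - 1}" if "x \<in> D" for x using c c' \<open>m \<ge> 6\<close> by (auto simp: col_def)
          show "col x \<noteq> g y" if "x \<in> D" "y \<in> intersection_points (N - {s})" "u \<in> N" "x \<in> u" "y \<in> u" for x y u
          proof -
            consider "x = p" | "x = q" "x \<noteq> p" | "x \<noteq> p" "x \<noteq> q" by blast
            then show ?thesis
            proof cases
              case 1
              then show ?thesis using conflict[OF that] \<open>B = {}\<close> c' by (auto simp: col_def)
            next
              case 2
              then show ?thesis using conflict[OF that] \<open>B = {}\<close> c by (auto simp: col_def)
            next
              case 3
              then have "col x = m - 1" by (simp add: col_def)
              then show ?thesis using gq[OF that(2)] by metis
            qed
          qed
        qed blast
        then show ?thesis unfolding m_def by blast
      qed
    qed
  qed
qed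

section \<open>The graph of a segment set\<close>

lemma segment_set_finite: "segment_set M \<Longrightarrow> finite M"
  by (simp add: segment_set_def)

lemma segment_set_is_segment: "segment_set M \<Longrightarrow> s \<in> M \<Longrightarrow> is_segment s"
  by (simp add: segment_set_def)

lemma segment_collinear_triple:
  assumes "is_segment s" "x \<in> s" "y \<in> s" "z \<in> s"
  shows "collinear {x, y, z}"
proof -
  have "collinear s" using assms(1) unfolding is_segment_def by auto
  then show ?thesis by (rule collinear_subset) (use assms in auto)
qed

lemma segment_set_linear_family:
  assumes "segment_set M"
  shows "linear_family M"
proof -
  have "p = q" if st: "s \<in> M" "t \<in> M" "s \<noteq> t" and p: "p \<in> s \<inter> t" and q: "q \<in> s \<inter> t" for s t p q
  proof (rule ccontr)
    assume "p \<noteq> q"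
    have "\<forall>x\<in>s \<union> t. collinear {p, q, x}"
      using segment_collinear_triple segment_set_is_segment[OF assms] st p q by blast
    then have "collinear (insert p (insert q (s \<union> t)))"
      using collinear_triples[OF \<open>p \<noteq> q\<close>] by blast
    then have "collinear (s \<union> t)" by (rule collinear_subset) auto
    then show False using assms st p unfolding segment_set_def by blast
  qed
  then show ?thesis unfolding linear_family_def using segment_set_finite[OF assms] by blast
qed

lemma finite_seg_verts:
  assumes "segment_set M"
  shows "finite (seg_verts M)"
proof -
  have "finite (endpoints s)" if "s \<in> M" for s
    using segment_set_is_segment[OF assms that]
    unfolding is_segment_def by (auto simp: endpoints_closed_segment)
  then show ?thesis
    using assms finite_intersection_points segment_set_linear_family segment_set_finite
    unfolding seg_verts_def segment_endpoints_def by blast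
qed

text \<open>Only the segments are restricted to \<open>N\<close>; the vertices, and hence adjacency,
  are still those of \<open>M\<close>. For \<open>N \<subseteq> M\<close> this gives a subgraph of
  G_M, which inherits the cactus property.\<close>

definition segment_edges :: "point set set \<Rightarrow> point set set \<Rightarrow> (point \<times> point) set" where
  "segment_edges M N = (\<Union>s\<in>N. {(u, v). u \<in> seg_verts M \<inter> s \<and> v \<in> seg_verts M \<inter> s \<and> u \<noteq> v \<and>
     \<not> (\<exists>w\<in>seg_verts M. w \<in> s \<and> w \<in> open_segment u v)})"

lemma seg_adj_iff_segment_edges: "seg_adj M u v \<longleftrightarrow> (u, v) \<in> segment_edges M M"
  unfolding seg_adj_def segment_edges_def by blast

lemma segment_edges_mono: "N \<subseteq> N' \<Longrightarrow> segment_edges M N \<subseteq> segment_edges M N'"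
  unfolding segment_edges_def by (rule UN_mono) auto

lemma segment_edges_subset: "segment_edges M N \<subseteq> (seg_verts M \<inter> \<Union>N) \<times> (seg_verts M \<inter> \<Union>N)"
  unfolding segment_edges_def by blast

lemma sym_segment_edges: "sym (segment_edges M N)"
  unfolding sym_def segment_edges_def by (auto simp: open_segment_commute)

lemma irrefl_segment_edges: "irrefl (segment_edges M N)"
  unfolding irrefl_def segment_edges_def by blast

section \<open>Cycles in the graph of a segment set\<close>

lemma closed_path_neighbours:
  assumes "closed_path A c" "sym A" "x \<in> set c"
  obtains a b where "a \<in> set c" "b \<in> set c" "a \<noteq> b" "(x, a) \<in> A" "(x, b) \<in> A"
proof -
  obtain c1 c2 where c: "c = c1 @ x # c2" using split_list[OF assms(3)] by blast
  define ys where "ys = c2 @ c1"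
  have "closed_path A (x # ys)"
    using closed_path_rotate[of A c1 "x # c2"] assms(1) unfolding c ys_def by simp
  then have ys: "length ys \<ge> 2" "distinct ys" "(x, hd ys) \<in> A" "(last ys, x) \<in> A"
    by (auto simp: closed_path_def simple_path_def successively_Cons split: if_splits)
  then obtain y z zs where "ys = y # z # zs" by (cases ys rule: remdups_adj.cases) auto
  then have "hd ys \<noteq> last ys" using ys(2) by auto
  moreover have "ys \<noteq> []" "set ys \<subseteq> set c" using ys(1) by (auto simp: c ys_def)
  then have "hd ys \<in> set c" "last ys \<in> set c" by auto
  ultimately show thesis using that ys(3,4) assms(2) by (meson symD)
qed

text \<open>If both cycle neighbours of \<open>x\<close> lay on one segment, the three points would
  be collinear. Then either \<open>x\<close> is between its neighbours, against extremality, or one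
  neighbour is between \<open>x\<close> and the other, against adjacency.\<close>

lemma extreme_cycle_vertex:
  assumes M: "segment_set M" and N: "N \<subseteq> M" and c: "closed_path (segment_edges M N) c"
    and x: "x extreme_point_of (convex hull (set c))"
  obtains a b s t where "a \<in> set c" "b \<in> set c" "x \<noteq> a" "x \<noteq> b"
    "s \<in> N" "t \<in> N" "s \<noteq> t" "x \<in> s" "a \<in> s" "x \<in> t" "b \<in> t"
proof -
  have "x \<in> set c" using x extreme_point_of_convex_hull by blast
  then obtain a b where ab: "a \<in> set c" "b \<in> set c" "a \<noteq> b"
    "(x, a) \<in> segment_edges M N" "(x, b) \<in> segment_edges M N"
    by (rule closed_path_neighbours[OF c sym_segment_edges])
  obtain s where s: "s \<in> N" "x \<in> s" "a \<in> s" "x \<noteq> a" "a \<in> seg_verts M"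
    "\<And>w. w \<in> seg_verts M \<Longrightarrow> w \<in> s \<Longrightarrow> w \<notin> open_segment x a"
    using ab(4) unfolding segment_edges_def by blast
  obtain t where t: "t \<in> N" "x \<in> t" "b \<in> t" "x \<noteq> b" "b \<in> seg_verts M"
    "\<And>w. w \<in> seg_verts M \<Longrightarrow> w \<in> t \<Longrightarrow> w \<notin> open_segment x b"
    using ab(5) unfolding segment_edges_def by blast
  have "s \<noteq> t"
  proof
    assume "s = t"
    have "is_segment s" using M N s(1) segment_set_is_segment by blast
    then have "collinear {x, a, b}"
      using segment_collinear_triple s t \<open>s = t\<close> by blast
    then have "x \<in> open_segment a b \<or> a \<in> open_segment x b \<or> b \<in> open_segment x a"
      using collinear_between_cases[of x a b] ab(3) s(4) t(4)
      by (auto simp: between_mem_segment open_segment_def closed_segment_commute)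
    moreover have "x \<notin> open_segment a b"
      using x ab(1,2) hull_subset[of "set c" convex] unfolding extreme_point_of_def by blast
    ultimately show False using s(3,5,6) t(3,5,6) \<open>s = t\<close> by blast
  qed
  then show thesis using that ab s t by blast
qed

lemma cycle_extreme_points_subset:
  assumes "segment_set M" "N \<subseteq> M" "closed_path (segment_edges M N) c"
  shows "{x. x extreme_point_of (convex hull (set c))} \<subseteq> set c \<inter> intersection_points N"
proof
  fix x assume "x \<in> {x. x extreme_point_of (convex hull (set c))}"
  then have x: "x extreme_point_of (convex hull (set c))" by simp
  then obtain a b s t where "s \<in> N" "t \<in> N" "s \<noteq> t" "x \<in> s" "x \<in> t"
    by (rule extreme_cycle_vertex[OF assms])
  then show "x \<in> set c \<inter> intersection_points N"
    using extreme_point_of_convex_hull[OF x] unfolding intersection_points_def by blast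
qed

text \<open>An extreme point of the hull has cycle neighbours on two different segments. If the
  cycle lay on a line, both segments would lie on that line, against the merging convention.\<close>

lemma cycle_not_collinear:
  assumes M: "segment_set M" and N: "N \<subseteq> M" and c: "closed_path (segment_edges M N) c"
  shows "\<not> collinear (set c)"
proof
  assume col: "collinear (set c)"
  have "set c \<noteq> {}" using c by (auto simp: closed_path_def)
  then obtain x where x: "x extreme_point_of (convex hull (set c))"
    using extreme_point_exists_convex[of "convex hull (set c)"]
    by (auto simp: finite_imp_compact_convex_hull)
  then have "x \<in> set c" by (rule extreme_point_of_convex_hull)
  obtain a b s t where abst: "a \<in> set c" "b \<in> set c" "x \<noteq> a" "x \<noteq> b"
    "s \<in> N" "t \<in> N" "s \<noteq> t" "x \<in> s" "a \<in> s" "x \<in> t" "b \<in> t"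
    using x by (rule extreme_cycle_vertex[OF assms])
  have seg: "is_segment s" "is_segment t"
    using M N abst segment_set_is_segment by blast+
  have xab: "collinear {a, x, b}"
    using col by (rule collinear_subset) (use abst \<open>x \<in> set c\<close> in auto)
  have "collinear {x, a, y}" if "y \<in> s \<union> t" for y
  proof (cases "y \<in> s")
    case True
    then show ?thesis using segment_collinear_triple[OF seg(1)] abst by blast
  next
    case False
    then have "collinear {x, b, y}" using segment_collinear_triple[OF seg(2)] abst that by blast
    then have "collinear {a, x, y}" using collinear_3_trans[OF xab] abst by blast
    then show ?thesis by (simp add: insert_commute)
  qed
  then have "collinear (insert x (insert a (s \<union> t)))"
    using collinear_triples[OF \<open>x \<noteq> a\<close>] by blast
  then have "collinear (s \<union> t)" by (rule collinear_subset) auto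
  then show False using M N abst unfolding segment_set_def by blast
qed

text \<open>By Krein-Milman the cycle lies in the affine hull of the extreme points of its convex hull.\<close>
lemma cycle_intersection_points_not_collinear:
  assumes "segment_set M" "N \<subseteq> M" "closed_path (segment_edges M N) c"
  shows "\<not> collinear (set c \<inter> intersection_points N)"
proof
  let ?E = "{x. x extreme_point_of (convex hull (set c))}"
  assume "collinear (set c \<inter> intersection_points N)"
  then have "collinear ?E"
    using cycle_extreme_points_subset[OF assms] by (rule collinear_subset)
  then have "collinear (affine hull ?E)" by (simp add: collinear_affine_hull_collinear)
  moreover have "set c \<subseteq> affine hull ?E"
  proof -
    have "set c \<subseteq> convex hull (set c)" by (rule hull_subset)
    also have "\<dots> = convex hull ?E"
      by (rule Krein_Milman_Minkowski) (auto simp: finite_imp_compact_convex_hull)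
    also have "\<dots> \<subseteq> affine hull ?E" by (rule convex_hull_subset_affine_hull)
    finally show ?thesis .
  qed
  ultimately have "collinear (set c)" by (rule collinear_subset)
  then show False using cycle_not_collinear[OF assms] by blast
qed

section \<open>Counting edges along the segments\<close>

lemma card_consecutive_pairs_ge:
  fixes \<phi> :: "'a \<Rightarrow> real"
  assumes fin: "finite X" and inj: "inj_on \<phi> X"
  shows "card X - 1 \<le> card {(u, v). u \<in> X \<and> v \<in> X \<and> \<phi> u < \<phi> v \<and> \<not> (\<exists>w\<in>X. \<phi> u < \<phi> w \<and> \<phi> w < \<phi> v)}"
    (is "_ \<le> card ?B")
proof (cases "X = {}")
  case False
  have "?B \<subseteq> X \<times> X" by auto
  then have finB: "finite ?B" using fin finite_subset by blast
  obtain z where z: "z \<in> X" "\<forall>x\<in>X. \<phi> x \<le> \<phi> z"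
    using arg_min_if_finite[OF fin False, of "\<lambda>x. - \<phi> x"] by force
  \<comment> \<open>Every element but the largest has a successor in the order given by
    \<open>\<phi>\<close>.\<close>
  have "u \<in> fst ` ?B" if u: "u \<in> X - {z}" for u
  proof -
    let ?Y = "{v \<in> X. \<phi> u < \<phi> v}"
    have "\<phi> u \<noteq> \<phi> z" using u z inj by (auto simp: inj_on_def)
    then have "?Y \<noteq> {}" using u z by force
    then obtain v where "v \<in> ?Y" "\<not> (\<exists>w\<in>?Y. \<phi> w < \<phi> v)"
      using arg_min_if_finite[of ?Y \<phi>] fin by auto
    then have "(u, v) \<in> ?B" using u by auto
    then show ?thesis by force
  qed
  then have "card (X - {z}) \<le> card (fst ` ?B)" using finB by (intro card_mono) auto
  also have "\<dots> \<le> card ?B" using finB by (rule card_image_le)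
  finally show ?thesis using z by simp
qed simp

text \<open>The inner product \<open>\<phi>\<close> with the direction of the segment orders its
  points strictly. Consecutive points in this order are neighbours, and each such pair counts in
  both directions.\<close>

lemma card_segment_neighbours_ge:
  assumes s: "is_segment s" and fin: "finite W"
  shows "2 * (card (W \<inter> s) - 1)
    \<le> card {(u, v). u \<in> W \<inter> s \<and> v \<in> W \<inter> s \<and> u \<noteq> v \<and> \<not> (\<exists>w\<in>W. w \<in> s \<and> w \<in> open_segment u v)}"
    (is "_ \<le> card ?A")
proof -
  obtain a b where ab: "a \<noteq> b" "s = closed_segment a b" using s unfolding is_segment_def by blast
  define \<phi> where "\<phi> x = x \<bullet> (b - a)" for x
  have pos: "0 < (b - a) \<bullet> (b - a)" using ab by simp
  have "inj_on \<phi> s"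
  proof (rule inj_onI)
    fix x y assume xy: "x \<in> s" "y \<in> s" "\<phi> x = \<phi> y"
    then obtain t t' where t: "x = a + t *\<^sub>R (b - a)" "y = a + t' *\<^sub>R (b - a)"
      unfolding ab(2) in_segment by (auto simp: algebra_simps)
    then have "t * ((b - a) \<bullet> (b - a)) = t' * ((b - a) \<bullet> (b - a))"
      using xy(3) by (simp add: \<phi>_def inner_add_left)
    then show "x = y" using pos t by simp
  qed
  then have inj: "inj_on \<phi> (W \<inter> s)" by (rule inj_on_subset) auto
  define X where "X = W \<inter> s"
  define B where "B = {(u, v). u \<in> X \<and> v \<in> X \<and> \<phi> u < \<phi> v \<and> \<not> (\<exists>w\<in>X. \<phi> u < \<phi> w \<and> \<phi> w < \<phi> v)}"
  have le: "card X - 1 \<le> card B"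
    unfolding B_def by (rule card_consecutive_pairs_ge) (use fin inj in \<open>auto simp: X_def\<close>)
  have between: "\<phi> u < \<phi> w \<and> \<phi> w < \<phi> v" if w: "w \<in> open_segment u v" and uv: "\<phi> u < \<phi> v" for u v w
  proof -
    obtain r where r: "0 < r" "r < 1" "w = (1 - r) *\<^sub>R u + r *\<^sub>R v"
      using w by (auto simp: in_segment)
    have "\<phi> w = (1 - r) * \<phi> u + r * \<phi> v"
      unfolding r(3) \<phi>_def by (simp add: inner_add_left)
    then have "\<phi> w = \<phi> u + r * (\<phi> v - \<phi> u)"
      by (simp add: algebra_simps)
    moreover have "0 < r * (\<phi> v - \<phi> u)" "r * (\<phi> v - \<phi> u) < 1 * (\<phi> v - \<phi> u)"
      using r uv by (auto intro: mult_strict_right_mono)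
    ultimately show ?thesis by simp
  qed
  have "B \<subseteq> X \<times> X" unfolding B_def by auto
  then have finB: "finite B" using fin finite_subset unfolding X_def by blast
  have "B \<inter> prod.swap ` B = {}" unfolding B_def by auto
  then have two: "card (B \<union> prod.swap ` B) = card B + card B"
    using finB by (subst card_Un_disjoint) (auto simp: card_image)
  have sub: "B \<union> prod.swap ` B \<subseteq> ?A"
  proof -
    have "(u, v) \<in> ?A \<and> (v, u) \<in> ?A" if "(u, v) \<in> B" for u v
    proof -
      have uv: "u \<in> X" "v \<in> X" "\<phi> u < \<phi> v" "\<And>w. w \<in> X \<Longrightarrow> \<not> (\<phi> u < \<phi> w \<and> \<phi> w < \<phi> v)"
        using that unfolding B_def by auto
      then have "\<not> (\<exists>w\<in>W. w \<in> s \<and> w \<in> open_segment u v)"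
        using between unfolding X_def by blast
      then show ?thesis using uv(1-3) unfolding X_def by (auto simp: open_segment_commute)
    qed
    then show ?thesis by auto
  qed
  have "?A \<subseteq> (W \<inter> s) \<times> (W \<inter> s)" by auto
  then have "finite ?A" using fin finite_subset by blast
  then have "card (B \<union> prod.swap ` B) \<le> card ?A" using sub by (rule card_mono)
  then show ?thesis using le two unfolding X_def by simp
qed

text \<open>Two distinct points lie on at most one common segment, so the edge sets of different
  segments are disjoint and their sizes add up.\<close>

lemma card_segment_edges_ge:
  assumes M: "segment_set M" and N: "N \<subseteq> M"
  shows "2 * (\<Sum>s\<in>N. card (seg_verts M \<inter> s) - 1) \<le> card (segment_edges M N)"
proof -
  let ?E = "\<lambda>s. {(u, v). u \<in> seg_verts M \<inter> s \<and> v \<in> seg_verts M \<inter> s \<and> u \<noteq> v \<and>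
     \<not> (\<exists>w\<in>seg_verts M. w \<in> s \<and> w \<in> open_segment u v)}"
  have finW: "finite (seg_verts M)" using M by (rule finite_seg_verts)
  have "finite N" using M N segment_set_finite finite_subset by blast
  have "card (segment_edges M N) = (\<Sum>s\<in>N. card (?E s))"
    unfolding segment_edges_def
  proof (rule card_UN_disjoint)
    show "\<forall>s\<in>N. finite (?E s)"
    proof
      fix s
      have "?E s \<subseteq> seg_verts M \<times> seg_verts M" by auto
      then show "finite (?E s)" using finW finite_subset by blast
    qed
    show "\<forall>s\<in>N. \<forall>t\<in>N. s \<noteq> t \<longrightarrow> ?E s \<inter> ?E t = {}"
      using linear_familyD[OF segment_set_linear_family[OF M]] N by blast
  qed fact
  moreover have "(\<Sum>s\<in>N. 2 * (card (seg_verts M \<inter> s) - 1)) \<le> (\<Sum>s\<in>N. card (?E s))"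
    using card_segment_neighbours_ge[OF _ finW] segment_set_is_segment[OF M] N
    by (intro sum_mono) blast
  ultimately show ?thesis by (simp add: sum_distrib_left)
qed

text \<open>With V the vertices on \<open>N\<close>, the edges number at least 2 (Sum d(v) - |N|)
  over V, and the cactus bound caps them at 2 |V| + |P| - 3. Vertices outside P contribute at least
  one each to the sum, so |V| cancels and 2 Sum d(p) + 3 <= 2 |N| + 3 |P| remains.\<close>

lemma segment_cactus_sparse_family:
  assumes "segment_cactus M"
  shows "sparse_family M"
  unfolding sparse_family_def
proof (intro allI impI)
  fix N assume N: "N \<subseteq> M" and card_N: "card N \<ge> 2"
  let ?P = "intersection_points N" and ?d = "point_degree N"
  have M: "segment_set M" and cactus: "is_cactus (seg_verts M) (seg_adj M)"
    using assms by (auto simp: segment_cactus_def)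
  have lin: "linear_family N"
    using segment_set_linear_family[OF M] N linear_family_subset by blast
  have finN: "finite N" and finP: "finite ?P"
    using lin linear_family_finite finite_intersection_points by blast+
  show "4 * sum ?d ?P + 6 \<le> 4 * card N + 6 * card ?P"
  proof (cases "?P = {}")
    case True
    then show ?thesis using card_N by simp
  next
    case False
    let ?V = "seg_verts M \<inter> \<Union>N"
    have finV: "finite ?V" using finite_seg_verts[OF M] by simp
    have PV: "?P \<subseteq> ?V"
      using N unfolding seg_verts_def intersection_points_def by blast
    have "card (segment_edges M N) + 3 \<le> 2 * card ?V + max 1 (card ?P)"
    proof (rule cactus_edge_bound)
      show "is_cactus ?V (\<lambda>u v. (u, v) \<in> segment_edges M N)"
        by (rule is_cactus_mono[OF cactus])
          (use segment_edges_mono[OF N, of M] in \<open>auto simp: seg_adj_iff_segment_edges\<close>)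
      \<comment> \<open>At most two points are always collinear, so a non-collinear set has at least
        three.\<close>
      show "card (set c \<inter> ?P) \<ge> 3" if "closed_path (segment_edges M N) c" for c
        using cycle_intersection_points_not_collinear[OF M N that] collinear_small[of "set c \<inter> ?P"]
        by fastforce
    qed (use finV finP False PV sym_segment_edges irrefl_segment_edges segment_edges_subset in auto)
    moreover have "card ?P \<ge> 1" using False finP by (simp add: Suc_le_eq card_gt_0_iff)
    moreover have "(\<Sum>s\<in>N. card (seg_verts M \<inter> s)) \<le> (\<Sum>s\<in>N. (card (seg_verts M \<inter> s) - 1) + 1)"
      by (rule sum_mono) simp
    then have "(\<Sum>s\<in>N. card (seg_verts M \<inter> s)) \<le> (\<Sum>s\<in>N. card (seg_verts M \<inter> s) - 1) + card N"
      by (subst (asm) sum.distrib) simp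
    moreover have "(\<Sum>s\<in>N. card (seg_verts M \<inter> s)) = (\<Sum>v\<in>?V. ?d v)"
    proof -
      have "(\<Sum>s\<in>N. \<Sum>v\<in>{v. v \<in> ?V \<and> v \<in> s}. 1) = (\<Sum>v\<in>?V. \<Sum>s\<in>{s. s \<in> N \<and> v \<in> s}. (1::nat))"
        using finN finV by (rule sum.swap_restrict)
      moreover have "{v. v \<in> ?V \<and> v \<in> s} = seg_verts M \<inter> s" if "s \<in> N" for s using that by auto
      ultimately show ?thesis by (simp add: point_degree_def)
    qed
    moreover have "sum ?d ?P + (card ?V - card ?P) \<le> (\<Sum>v\<in>?V. ?d v)"
    proof -
      have "1 \<le> ?d v" if "v \<in> ?V - ?P" for v
      proof -
        obtain s where "s \<in> N" "v \<in> s" using \<open>v \<in> ?V - ?P\<close> by blast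
        then show ?thesis unfolding point_degree_def using finN by (auto simp: Suc_le_eq card_gt_0_iff)
      qed
      then have "card (?V - ?P) \<le> sum ?d (?V - ?P)"
        using sum_bounded_below[of "?V - ?P" 1 ?d] by simp
      moreover have "sum ?d ?V = sum ?d (?V - ?P) + sum ?d ?P"
        using finV PV by (intro sum.subset_diff) auto
      ultimately show ?thesis using card_Diff_subset[OF finP PV] by simp
    qed
    moreover have "card ?P \<le> card ?V" using finV PV by (rule card_mono)
    ultimately show ?thesis
      using card_segment_edges_ge[OF M N] by linarith
  qed
qed

section \<open>Combs\<close>

definition comb_base :: "nat \<Rightarrow> point set" where
  "comb_base m = closed_segment (vector [0, 0]) (vector [real m, 0])"

definition comb_tooth :: "nat \<Rightarrow> point set" where
  "comb_tooth i = closed_segment (vector [real i, 0]) (vector [real i, 1])"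

text \<open>The parameter counts all segments, so there is one tooth fewer.\<close>

definition comb :: "nat \<Rightarrow> point set set" where
  "comb m = insert (comb_base m) (comb_tooth ` {1..<m})"

lemma mem_comb_base:
  assumes "m > 0"
  shows "p \<in> comb_base m \<longleftrightarrow> p $ 2 = 0 \<and> 0 \<le> p $ 1 \<and> p $ 1 \<le> real m"
proof
  assume "p \<in> comb_base m"
  then obtain u where "0 \<le> u" "u \<le> 1" "p = (1 - u) *\<^sub>R vector [0, 0] + u *\<^sub>R vector [real m, 0]"
    unfolding comb_base_def in_segment by blast
  then show "p $ 2 = 0 \<and> 0 \<le> p $ 1 \<and> p $ 1 \<le> real m"
    by (simp add: mult_left_le_one_le)
next
  assume p: "p $ 2 = 0 \<and> 0 \<le> p $ 1 \<and> p $ 1 \<le> real m"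
  show "p \<in> comb_base m"
    unfolding comb_base_def in_segment
    by (rule exI[of _ "p $ 1 / real m"]) (use p assms in \<open>auto simp: vec_eq_iff forall_2\<close>)
qed

lemma mem_comb_tooth: "p \<in> comb_tooth i \<longleftrightarrow> p $ 1 = real i \<and> 0 \<le> p $ 2 \<and> p $ 2 \<le> 1"
proof
  assume "p \<in> comb_tooth i"
  then obtain u where "0 \<le> u" "u \<le> 1" "p = (1 - u) *\<^sub>R vector [real i, 0] + u *\<^sub>R vector [real i, 1]"
    unfolding comb_tooth_def in_segment by blast
  then show "p $ 1 = real i \<and> 0 \<le> p $ 2 \<and> p $ 2 \<le> 1"
    by (simp add: left_diff_distrib)
next
  assume p: "p $ 1 = real i \<and> 0 \<le> p $ 2 \<and> p $ 2 \<le> 1"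
  show "p \<in> comb_tooth i"
    unfolding comb_tooth_def in_segment
    by (rule exI[of _ "p $ 2"]) (use p in \<open>auto simp: vec_eq_iff forall_2 algebra_simps\<close>)
qed

lemma comb_base_neq_tooth: "m > 0 \<Longrightarrow> comb_base m \<noteq> comb_tooth i"
  using mem_comb_base[of m "vector [real i, 1]"] mem_comb_tooth[of "vector [real i, 1]" i] by auto

lemma inj_comb_tooth: "inj comb_tooth"
proof
  fix i j assume "comb_tooth i = comb_tooth j"
  then have "vector [real i, 0] \<in> comb_tooth j"
    using mem_comb_tooth[of "vector [real i, 0]" i] by simp
  then show "i = j" by (simp add: mem_comb_tooth)
qed

lemma card_comb:
  assumes "m > 0"
  shows "card (comb m) = m"
proof -
  have "card (comb_tooth ` {1..<m}) = m - 1"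
    using inj_comb_tooth by (simp add: card_image inj_on_subset)
  moreover have "comb_base m \<notin> comb_tooth ` {1..<m}" using comb_base_neq_tooth[OF assms] by blast
  ultimately show ?thesis using assms by (simp add: comb_def)
qed

lemma intersection_points_comb:
  "intersection_points (comb m) = (\<lambda>i. vector [real i, 0]) ` {1..<m}" (is "?L = ?R")
proof (cases "m > 0")
  case True
  show ?thesis
  proof
    show "?R \<subseteq> ?L"
    proof
      fix p assume "p \<in> ?R"
      then obtain i where i: "i \<in> {1..<m}" "p = vector [real i, 0]" by blast
      then have "p \<in> comb_base m" "p \<in> comb_tooth i"
        by (simp_all add: mem_comb_base mem_comb_tooth)
      then show "p \<in> ?L"
        using i(1) comb_base_neq_tooth[OF True] unfolding intersection_points_def comb_def by blast
    qed
    show "?L \<subseteq> ?R"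
    proof
      fix p assume "p \<in> ?L"
      then obtain s t where st: "s \<in> comb m" "t \<in> comb m" "s \<noteq> t" "p \<in> s" "p \<in> t"
        unfolding intersection_points_def by blast
      have "s = comb_base m \<or> t = comb_base m"
      proof (rule ccontr)
        assume "\<not> ?thesis"
        then obtain i j where ij: "s = comb_tooth i" "t = comb_tooth j"
          using st(1,2) unfolding comb_def by blast
        then have "i = j" using st(4,5) by (simp add: mem_comb_tooth)
        then show False using ij st(3) by simp
      qed
      then have "\<exists>u\<in>comb_tooth ` {1..<m}. p \<in> comb_base m \<and> p \<in> u"
        using st unfolding comb_def by (elim disjE) (simp_all, blast+)
      then obtain i where i: "i \<in> {1..<m}" "p \<in> comb_base m" "p \<in> comb_tooth i" by blast
      then have "p = vector [real i, 0]"
        using mem_comb_base[OF True] by (simp add: mem_comb_tooth vec_eq_iff forall_2)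
      then show "p \<in> ?R" using i by blast
    qed
  qed
qed (simp add: comb_def intersection_points_def)

lemma card_intersection_points_comb: "card (intersection_points (comb m)) = m - 1"
proof -
  have "inj_on (\<lambda>i. vector [real i, 0] :: point) {1..<m}"
    by (auto simp: inj_on_def vec_eq_iff forall_2)
  then show ?thesis by (simp add: intersection_points_comb card_image)
qed

lemma segment_set_comb:
  assumes "m > 0"
  shows "segment_set (comb m)"
proof -
  have "is_segment (comb_base m)" "is_segment (comb_tooth i)" for i
  proof -
    have "vector [0, 0] \<noteq> (vector [real m, 0] :: point)" "vector [real i, 0] \<noteq> (vector [real i, 1] :: point)"
      using assms by (simp_all add: vec_eq_iff forall_2)
    then show "is_segment (comb_base m)" "is_segment (comb_tooth i)"
      unfolding is_segment_def comb_base_def comb_tooth_def by blast+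
  qed
  moreover have noncol: "\<not> collinear (comb_base m \<union> comb_tooth i)" for i
  proof
    assume "collinear (comb_base m \<union> comb_tooth i)"
    then have "collinear {vector [0, 0], vector [real i, 1], vector [real m, 0] :: point}"
      by (rule collinear_subset) (use assms in \<open>auto simp: mem_comb_base mem_comb_tooth\<close>)
    then show False
      using assms by (auto simp: collinear_3_expand vec_eq_iff forall_2)
  qed
  moreover have "comb_tooth i \<inter> comb_tooth j = {}" if "i \<noteq> j" for i j
    using that by (auto simp: mem_comb_tooth)
  moreover have "s = comb_base m \<or> (\<exists>i. s = comb_tooth i)" if "s \<in> comb m" for s
    using that unfolding comb_def by blast
  moreover have "finite (comb m)" by (simp add: comb_def)
  ultimately show ?thesis
    unfolding segment_set_def by (metis Un_commute)
qed

text \<open>All intersection points lie on the base, whereas a cycle needs non-collinear ones. So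
  the graph has no cycle at all.\<close>

lemma segment_cactus_comb:
  assumes "m > 0"
  shows "segment_cactus (comb m)"
proof -
  have M: "segment_set (comb m)" using assms by (rule segment_set_comb)
  have col: "collinear (intersection_points (comb m))"
  proof (rule collinear_subset)
    show "collinear (comb_base m)" by (simp add: comb_base_def)
    show "intersection_points (comb m) \<subseteq> comb_base m"
      using assms by (auto simp: intersection_points_comb mem_comb_base)
  qed
  have "\<not> is_cycle (seg_verts (comb m)) (seg_adj (comb m)) xs" for xs
  proof
    assume "is_cycle (seg_verts (comb m)) (seg_adj (comb m)) xs"
    then have "closed_path (segment_edges (comb m) (comb m)) xs"
      using is_cycle_iff_closed_path[of "segment_edges (comb m) (comb m)" "seg_verts (comb m)" xs]
        segment_edges_subset[of "comb m" "comb m"]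
      unfolding seg_adj_iff_segment_edges[abs_def] by blast
    then have "\<not> collinear (set xs \<inter> intersection_points (comb m))"
      by (rule cycle_intersection_points_not_collinear[OF M subset_refl])
    then show False using collinear_subset[OF col] by blast
  qed
  then show ?thesis using M by (simp add: segment_cactus_def is_cactus_def)
qed

text \<open>The base alone carries m - 1 points, which need pairwise different colours.\<close>

lemma comb_not_colorable:
  assumes "m \<ge> 2"
  shows "\<not> EFL_coloring (comb m) (m - 2) f"
proof
  let ?P = "intersection_points (comb m)"
  assume f: "EFL_coloring (comb m) (m - 2) f"
  have "?P \<subseteq> comb_base m"
    using assms by (auto simp: intersection_points_comb mem_comb_base)
  moreover have "comb_base m \<in> comb m" by (simp add: comb_def)
  ultimately have "inj_on f ?P"
    using f unfolding EFL_coloring_def inj_on_def by blast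
  moreover have "f ` ?P \<subseteq> {1..m - 2}"
    using f unfolding EFL_coloring_def by blast
  ultimately have "card ?P \<le> card {1..m - 2}" by (intro card_inj_on_le) auto
  then show False using assms by (simp add: card_intersection_points_comb)
qed

theorem theorem9:
  "(\<forall>M m. segment_cactus M \<and> card M = m \<and>
        \<not> (card M = 3 \<and> card (intersection_points M) = 3) \<longrightarrow>
        (\<exists>f. EFL_coloring M (m - 1) f)) \<and>
   (\<forall>m\<ge>2. \<exists>M. segment_cactus M \<and> card M = m \<and>
        \<not> (card M = 3 \<and> card (intersection_points M) = 3) \<and>
        \<not> (\<exists>f. EFL_coloring M (m - 2) f))"
proof (intro conjI allI impI)
  fix M :: "point set set" and m
  assume M: "segment_cactus M \<and> card M = m \<and>
    \<not> (card M = 3 \<and> card (intersection_points M) = 3)"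
  then have "linear_family M" by (simp add: segment_cactus_def segment_set_linear_family)
  then have "\<exists>f. EFL_coloring M (card M - 1) f"
    using sparse_family_coloring segment_cactus_sparse_family M by blast
  then show "\<exists>f. EFL_coloring M (m - 1) f" using M by simp
next
  fix m :: nat assume m: "m \<ge> 2"
  then have "m > 0" by simp
  \<comment> \<open>The comb with three segments has only two intersection points, so it is not the
    excluded configuration.\<close>
  have "segment_cactus (comb m) \<and> card (comb m) = m \<and>
        \<not> (card (comb m) = 3 \<and> card (intersection_points (comb m)) = 3) \<and>
        \<not> (\<exists>f. EFL_coloring (comb m) (m - 2) f)"
    using segment_cactus_comb[OF \<open>m > 0\<close>] card_comb[OF \<open>m > 0\<close>] card_intersection_points_comb[of m]
      comb_not_colorable[OF m] by auto
  then show "\<exists>M. segment_cactus M \<and> card M = m \<and>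
        \<not> (card M = 3 \<and> card (intersection_points M) = 3) \<and>
        \<not> (\<exists>f. EFL_coloring M (m - 2) f)" by blast
qed

end
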